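(* Let $q\colon E\to M$ be a tangent display map in a tangent category $(\mathbb X,\mathbb T)$. There is a bijective correspondence between vertical connections on $q$ and vertical connection forms on $q$. Concretely, if $R\colon TE\to Vq$ is a vertical connection on $q$, then $\phi_R:=R\iota_q\colon TE\to TE$ is a vertical connection form on $q$. Conversely, if $\phi\colon TE\to TE$ is a vertical connection form on $q$, then the unique morphism $R_\phi\colon\mathbf p_E\to\mathbf q^V$ of $\mathsf{DB}(E)$ satisfying $R_\phi\iota_q=\phi$ and $R_\phi q^V=p_E$ (which exists) is a vertical connection on $q$.
   Context: Composition is diagrammatic: $fg$ is $f$ followed by $g$; $\langle f,g\rangle$ denotes pairing into a (fibred) product, with projections $\pi_1,\pi_2$. A tangent category $(\mathbb X,\mathbb T)$ is a category $\mathbb X$ with an endofunctor $T$ and natural transformations $p_M\colon TM\to M$, $z_M\colon M\to TM$, $s_M\colon T_2M\to TM$, $l_M\colon TM\to T^2M$, $c_M\colon T^2M\to T^2M$, where the $n$-fold pullback $T_nM$ of $p_M$ along itself exists and is preserved by all $T^m$, such that: $(p_M,z_M,s_M)$ is an additive bundle (a commutative monoid in the category over $M$); $(z_M,l_M)\colon p_M\to Tp_M$ and $(\mathrm{id}_{TM},c_M)\colon Tp_M\to p_{TM}$ are additive bundle morphisms (commutative squares preserving zero and sum); $c_Mc_M=\mathrm{id}$, $l_Mc_M=l_M$, $l_M\,Tl_M=l_M\,l_{TM}$, $Tc_M\,c_{TM}\,Tc_M=c_{TM}\,Tc_M\,c_{TM}$, $l_{TM}\,Tc_M\,c_{TM}=c_M\,Tl_M$;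 and, with $\xi_M=\langle\pi_1l_M,\pi_2z_{TM}\rangle\,Ts_M\colon T_2M\to T^2M$, the square $\xi_M\,Tp_M=\pi_1p_Mz_M$ is a tangent pullback. A tangent pullback is a pullback preserved by $T^m$ for all $m\ge0$. A tangent display map is a morphism $q\colon E\to M$ such that for all $n\ge0$ and all $f\colon N\to T^nM$ the pullback of $T^nq$ along $f$ exists and is a tangent pullback. A differential bundle $\mathbf q\colon E\to M$ consists of $q\colon E\to M$, $z_q\colon M\to E$, $s_q\colon E_2\to E$, $l_q\colon E\to TE$ ($E_n$ the $n$-fold pullback of $q$ along itself, required to exist and be preserved by all $T^m$) such that $(q,z_q,s_q)$ is an additive bundle, $(z_M,l_q)\colon q\to Tq$ and $(z_q,l_q)\colon q\to p_E$ are additive bundle morphisms, $l_ql_E=l_q\,Tl_q$, and with $\xi_q=\langle\pi_1l_q,\pi_2z_E\rangle\,Ts_q\colon E_2\to TE$ the square $\xi_q\,Tq=\pi_1qz_M$ is a tangent pullback. Convention: all differential bundles are assumed display, i.e. $q$ is a tangent display map. A morphism $(f,g)\colon\mathbf q\to\mathbf q'$ (with $qf=gq'$) is linear if $g\,l_{q'}=l_q\,Tg$. $\mathsf{DB}(E)$ is the category of differential bundles over $E$ and linear morphisms over $\mathrm{id}_E$. $\mathbf p_E=(p_E,z_E,s_E,l_E)$ is the tangent bundle. For a tangent display map $q\colon E\to M$, the vertical bundle $\mathbf q^V\colon Vq\to E$ is given by the tangent pullback $Vq$ of $Tq$ along $z_M$, with projections $\iota_q\colon Vq\to TE$ and $T^Vq\colon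 Vq\to M$; $q^V=\iota_qp_E$, and its zero $z_q^V$, sum $s^V_q$, lift $l_q^V$ are determined by $z_q^V\iota_q=z_E$, $s_q^V\iota_q=(\iota_q\times\iota_q)s_E$, $l_q^V\,T\iota_q=\iota_ql_E$. A vertical connection on $q$ is $R\colon TE\to Vq$ with $\iota_qR=\mathrm{id}_{Vq}$ and $R\colon\mathbf p_E\to\mathbf q^V$ linear over $E$ ($Rq^V=p_E$, $Rl_q^V=l_E\,TR$). A vertical connection form on $q$ is a morphism $\phi\colon TE\to TE$ such that $\iota_q\phi=\iota_q$; $\phi\colon\mathbf p_E\to\mathbf p_E$ is linear over $E$ ($\phi p_E=p_E$, $\phi l_E=l_E\,T\phi$); and $\phi\,Tq=p_E\,q\,z_M$. *)

theory Defs
  imports Main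
begin

section \<open>Categories\<close>

text \<open>Composition is diagrammatic: \<open>f \<cdot> g\<close> is \<open>f\<close> followed by \<open>g\<close>.  The class of
  objects and the class of morphisms are carriers inside arbitrary types; \<open>Id\<close>, \<open>Dom\<close>, \<open>Cod\<close>
  and \<open>\<cdot>\<close> are meaningless outside of them.\<close>

record ('o, 'a) category_data =
  Ob  :: "'o set"
  Ar  :: "'a set"
  Dom :: "'a \<Rightarrow> 'o"
  Cod :: "'a \<Rightarrow> 'o"
  Id  :: "'o \<Rightarrow> 'a"
  Comp :: "'a \<Rightarrow> 'a \<Rightarrow> 'a" (infixl "\<cdot>\<index>" 70)

definition hom :: "('o, 'a, 'm) category_data_scheme \<Rightarrow> 'o \<Rightarrow> 'o \<Rightarrow> 'a set" where
  "hom C A B = {f \<in> Ar C. Dom C f = A \<and> Cod C f = B}"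

locale category =
  fixes C :: "('o, 'a, 'm) category_data_scheme" (structure)
  assumes Dom_in_Ob: "f \<in> Ar C \<Longrightarrow> Dom C f \<in> Ob C"
    and Cod_in_Ob: "f \<in> Ar C \<Longrightarrow> Cod C f \<in> Ob C"
    and Id_in_hom: "A \<in> Ob C \<Longrightarrow> Id C A \<in> hom C A A"
    and Comp_in_hom: "f \<in> hom C A B \<Longrightarrow> g \<in> hom C B D \<Longrightarrow> f \<cdot> g \<in> hom C A D"
    and Id_left: "f \<in> hom C A B \<Longrightarrow> Id C A \<cdot> f = f"
    and Id_right: "f \<in> hom C A B \<Longrightarrow> f \<cdot> Id C B = f"
    and Comp_assoc: "f \<in> hom C A B \<Longrightarrow> g \<in> hom C B D \<Longrightarrow> h \<in> hom C D F \<Longrightarrow>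
      (f \<cdot> g) \<cdot> h = f \<cdot> (g \<cdot> h)"

text \<open>\<open>is_pullback C a b f g\<close>: the square \<open>a \<cdot> f = b \<cdot> g\<close> exhibits \<open>Dom a = Dom b\<close> as the
  pullback of \<open>f\<close> along \<open>g\<close>.\<close>

definition is_pullback :: "('o, 'a, 'm) category_data_scheme \<Rightarrow> 'a \<Rightarrow> 'a \<Rightarrow> 'a \<Rightarrow> 'a \<Rightarrow> bool" where
  "is_pullback C a b f g \<longleftrightarrow>
     a \<in> hom C (Dom C a) (Dom C f) \<and> b \<in> hom C (Dom C a) (Dom C g) \<and>
     f \<in> hom C (Dom C f) (Cod C f) \<and> g \<in> hom C (Dom C g) (Cod C f) \<and>
     a \<cdot> f = b \<cdot> g \<and>
     (\<forall>N. \<forall>h \<in> hom C N (Dom C f). \<forall>k \<in> hom C N (Dom C g). h \<cdot> f = k \<cdot> g \<longrightarrow>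
        (\<exists>!u. u \<in> hom C N (Dom C a) \<and> u \<cdot> a = h \<and> u \<cdot> b = k))" for C (structure)

text \<open>\<open>pairing C a b h k\<close> is \<open>\<langle>h, k\<rangle>\<close>, for a pullback with projections \<open>a\<close> and \<open>b\<close>.\<close>

definition pairing :: "('o, 'a, 'm) category_data_scheme \<Rightarrow> 'a \<Rightarrow> 'a \<Rightarrow> 'a \<Rightarrow> 'a \<Rightarrow> 'a" where
  "pairing C a b h k = (THE u. u \<in> hom C (Dom C h) (Dom C a) \<and> u \<cdot> a = h \<and> u \<cdot> b = k)"
  for C (structure)

text \<open>\<open>is_fibre_power C n q b \<pi>\<close>: \<open>Dom b\<close> is the \<open>n\<close>-fold pullback of \<open>q\<close> along itself, with
  projections \<open>\<pi> 0, \<dots>, \<pi> (n - 1)\<close> to \<open>Dom q\<close> and structure map \<open>b\<close> to \<open>Cod q\<close>; for \<open>n = 0\<close>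
  this says that \<open>b\<close> is an isomorphism.\<close>

definition is_fibre_power ::
  "('o, 'a, 'm) category_data_scheme \<Rightarrow> nat \<Rightarrow> 'a \<Rightarrow> 'a \<Rightarrow> (nat \<Rightarrow> 'a) \<Rightarrow> bool" where
  "is_fibre_power C n q b \<pi> \<longleftrightarrow>
     q \<in> Ar C \<and> b \<in> hom C (Dom C b) (Cod C q) \<and>
     (\<forall>i<n. \<pi> i \<in> hom C (Dom C b) (Dom C q) \<and> \<pi> i \<cdot> q = b) \<and>
     (\<forall>N \<rho>. \<forall>k \<in> hom C N (Cod C q). (\<forall>i<n. \<rho> i \<in> hom C N (Dom C q) \<and> \<rho> i \<cdot> q = k) \<longrightarrow>
        (\<exists>!u. u \<in> hom C N (Dom C b) \<and> u \<cdot> b = k \<and> (\<forall>i<n. u \<cdot> \<pi> i = \<rho> i)))" for C (structure)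


section \<open>Bundle data\<close>

text \<open>A projection \<open>q\<close> with its zero, a chosen pullback of \<open>q\<close> along itself (given by its two
  projections), its sum, and its lift.\<close>

record 'a bundle_data =
  bproj :: 'a
  bzero :: 'a
  bfst  :: 'a
  bsnd  :: 'a
  bsum  :: 'a
  blift :: 'a

text \<open>\<open>badd C B x y\<close> is \<open>\<langle>x, y\<rangle> s\<close>, the sum of two generalised elements of the total
  object lying over the same generalised element of the base.\<close>

definition badd :: "('o, 'a, 'm) category_data_scheme \<Rightarrow> 'a bundle_data \<Rightarrow> 'a \<Rightarrow> 'a \<Rightarrow> 'a" where
  "badd C B x y = pairing C (bfst B) (bsnd B) x y \<cdot> bsum B" for C (structure)

text \<open>Commutative monoids in the category over \<open>M\<close>.  The monoid laws are written on
  generalised elements; applied to the projections of the fibre powers they are the usual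
  diagrams.\<close>

definition additive_bundle :: "('o, 'a, 'm) category_data_scheme \<Rightarrow> 'a bundle_data \<Rightarrow> bool" where
  "additive_bundle C B \<longleftrightarrow> (let q = bproj B; E = Dom C q; M = Cod C q in
     is_pullback C (bfst B) (bsnd B) q q \<and>
     bzero B \<in> hom C M E \<and> bzero B \<cdot> q = Id C M \<and>
     bsum B \<in> hom C (Dom C (bfst B)) E \<and> bsum B \<cdot> q = bfst B \<cdot> q \<and>
     (\<forall>N. \<forall>x \<in> hom C N E. badd C B x (x \<cdot> q \<cdot> bzero B) = x) \<and>
     (\<forall>N. \<forall>x \<in> hom C N E. \<forall>y \<in> hom C N E. x \<cdot> q = y \<cdot> q \<longrightarrow> badd C B x y = badd C B y x) \<and>
     (\<forall>N. \<forall>x \<in> hom C N E. \<forall>y \<in> hom C N E. \<forall>w \<in> hom C N E. x \<cdot> q = y \<cdot> q \<and> y \<cdot> q = w \<cdot> q \<longrightarrow>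
        badd C B (badd C B x y) w = badd C B x (badd C B y w)))" for C (structure)

text \<open>Here \<open>f\<close> is the morphism between the bases and \<open>g\<close> the one between the total objects.\<close>

definition additive_morphism ::
  "('o, 'a, 'm) category_data_scheme \<Rightarrow> 'a bundle_data \<Rightarrow> 'a bundle_data \<Rightarrow> 'a \<Rightarrow> 'a \<Rightarrow> bool" where
  "additive_morphism C B B' f g \<longleftrightarrow>
     f \<in> hom C (Cod C (bproj B)) (Cod C (bproj B')) \<and>
     g \<in> hom C (Dom C (bproj B)) (Dom C (bproj B')) \<and>
     bproj B \<cdot> f = g \<cdot> bproj B' \<and>
     bzero B \<cdot> g = f \<cdot> bzero B' \<and>
     bsum B \<cdot> g = badd C B' (bfst B \<cdot> g) (bsnd B \<cdot> g)" for C (structure)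


section \<open>Tangent categories\<close>

text \<open>\<open>tfst M\<close> and \<open>tsnd M\<close> are the projections of the chosen \<open>T\<^sub>2M\<close>, which is their common
  domain.\<close>

record ('o, 'a) tangent_data = "('o, 'a) category_data" +
  tanO  :: "'o \<Rightarrow> 'o"
  tanA  :: "'a \<Rightarrow> 'a"
  tproj :: "'o \<Rightarrow> 'a"
  tzero :: "'o \<Rightarrow> 'a"
  tfst  :: "'o \<Rightarrow> 'a"
  tsnd  :: "'o \<Rightarrow> 'a"
  tsum  :: "'o \<Rightarrow> 'a"
  tlift :: "'o \<Rightarrow> 'a"
  tflip :: "'o \<Rightarrow> 'a"

definition tangent_bundle :: "('o, 'a, 'm) tangent_data_scheme \<Rightarrow> 'o \<Rightarrow> 'a bundle_data" where
  "tangent_bundle X M = \<lparr>bproj = tproj X M, bzero = tzero X M, bfst = tfst X M,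
     bsnd = tsnd X M, bsum = tsum X M, blift = tlift X M\<rparr>"

text \<open>The image under \<open>T\<close> of the additive bundle underlying \<open>B\<close>.  Its lift component plays no
  role (the lift of the tangent prolongation of a differential bundle involves \<open>c\<close>).\<close>

definition T_bundle :: "('o, 'a, 'm) tangent_data_scheme \<Rightarrow> 'a bundle_data \<Rightarrow> 'a bundle_data" where
  "T_bundle X B = \<lparr>bproj = tanA X (bproj B), bzero = tanA X (bzero B), bfst = tanA X (bfst B),
     bsnd = tanA X (bsnd B), bsum = tanA X (bsum B), blift = tanA X (blift B)\<rparr>"

definition tangent_pullback :: "('o, 'a, 'm) tangent_data_scheme \<Rightarrow> 'a \<Rightarrow> 'a \<Rightarrow> 'a \<Rightarrow> 'a \<Rightarrow> bool" where
  "tangent_pullback X a b f g \<longleftrightarrow>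
     (\<forall>m. is_pullback X ((tanA X ^^ m) a) ((tanA X ^^ m) b) ((tanA X ^^ m) f) ((tanA X ^^ m) g))"

definition has_tangent_fibre_powers :: "('o, 'a, 'm) tangent_data_scheme \<Rightarrow> 'a \<Rightarrow> bool" where
  "has_tangent_fibre_powers X q \<longleftrightarrow>
     (\<forall>n. \<exists>b \<pi>. \<forall>m. is_fibre_power X n ((tanA X ^^ m) q) ((tanA X ^^ m) b) (\<lambda>i. (tanA X ^^ m) (\<pi> i)))"

text \<open>\<open>\<xi> = \<langle>\<pi>\<^sub>1 l, \<pi>\<^sub>2 z\<^sub>E\<rangle> Ts : E\<^sub>2 \<rightarrow> TE\<close>, where \<open>z\<^sub>E\<close> is the zero of the tangent bundle of
  the total object \<open>E\<close>.\<close>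

definition xi :: "('o, 'a, 'm) tangent_data_scheme \<Rightarrow> 'a bundle_data \<Rightarrow> 'a" where
  "xi X B = badd X (T_bundle X B) (bfst B \<cdot> blift B) (bsnd B \<cdot> tzero X (Dom X (bproj B)))"
  for X (structure)

definition universal_lift :: "('o, 'a, 'm) tangent_data_scheme \<Rightarrow> 'a bundle_data \<Rightarrow> bool" where
  "universal_lift X B \<longleftrightarrow> tangent_pullback X (xi X B) (bfst B \<cdot> bproj B)
     (tanA X (bproj B)) (tzero X (Cod X (bproj B)))" for X (structure)

locale tangent_category = category X
  for X :: "('o, 'a, 'm) tangent_data_scheme" (structure) +
  assumes tanO_in_Ob: "M \<in> Ob X \<Longrightarrow> tanO X M \<in> Ob X"
    and tanA_in_hom: "f \<in> hom X M N \<Longrightarrow> tanA X f \<in> hom X (tanO X M) (tanO X N)"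
    and tanA_Id: "M \<in> Ob X \<Longrightarrow> tanA X (Id X M) = Id X (tanO X M)"
    and tanA_Comp: "f \<in> hom X M N \<Longrightarrow> g \<in> hom X N K \<Longrightarrow> tanA X (f \<cdot> g) = tanA X f \<cdot> tanA X g"
    and tproj_in_hom: "M \<in> Ob X \<Longrightarrow> tproj X M \<in> hom X (tanO X M) M"
    and tzero_in_hom: "M \<in> Ob X \<Longrightarrow> tzero X M \<in> hom X M (tanO X M)"
    and tsum_in_hom: "M \<in> Ob X \<Longrightarrow> tsum X M \<in> hom X (Dom X (tfst X M)) (tanO X M)"
    and tlift_in_hom: "M \<in> Ob X \<Longrightarrow> tlift X M \<in> hom X (tanO X M) (tanO X (tanO X M))"
    and tflip_in_hom: "M \<in> Ob X \<Longrightarrow> tflip X M \<in> hom X (tanO X (tanO X M)) (tanO X (tanO X M))"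
    and T2_tangent_pullback: "M \<in> Ob X \<Longrightarrow>
      tangent_pullback X (tfst X M) (tsnd X M) (tproj X M) (tproj X M)"
    and Tn_exist: "M \<in> Ob X \<Longrightarrow> has_tangent_fibre_powers X (tproj X M)"
    and tproj_natural: "f \<in> hom X M N \<Longrightarrow> tanA X f \<cdot> tproj X N = tproj X M \<cdot> f"
    and tzero_natural: "f \<in> hom X M N \<Longrightarrow> f \<cdot> tzero X N = tzero X M \<cdot> tanA X f"
    and tsum_natural: "f \<in> hom X M N \<Longrightarrow>
      pairing X (tfst X N) (tsnd X N) (tfst X M \<cdot> tanA X f) (tsnd X M \<cdot> tanA X f) \<cdot> tsum X N
        = tsum X M \<cdot> tanA X f"
    and tlift_natural: "f \<in> hom X M N \<Longrightarrow>
      tanA X f \<cdot> tlift X N = tlift X M \<cdot> tanA X (tanA X f)"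
    and tflip_natural: "f \<in> hom X M N \<Longrightarrow>
      tanA X (tanA X f) \<cdot> tflip X N = tflip X M \<cdot> tanA X (tanA X f)"
    and tangent_additive: "M \<in> Ob X \<Longrightarrow> additive_bundle X (tangent_bundle X M)"
    and tlift_additive: "M \<in> Ob X \<Longrightarrow>
      additive_morphism X (tangent_bundle X M) (T_bundle X (tangent_bundle X M))
        (tzero X M) (tlift X M)"
    and tflip_additive: "M \<in> Ob X \<Longrightarrow>
      additive_morphism X (T_bundle X (tangent_bundle X M)) (tangent_bundle X (tanO X M))
        (Id X (tanO X M)) (tflip X M)"
    and tflip_tflip: "M \<in> Ob X \<Longrightarrow> tflip X M \<cdot> tflip X M = Id X (tanO X (tanO X M))"
    and tlift_tflip: "M \<in> Ob X \<Longrightarrow> tlift X M \<cdot> tflip X M = tlift X M"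
    and tlift_tlift: "M \<in> Ob X \<Longrightarrow>
      tlift X M \<cdot> tanA X (tlift X M) = tlift X M \<cdot> tlift X (tanO X M)"
    and tflip_braid: "M \<in> Ob X \<Longrightarrow>
      tanA X (tflip X M) \<cdot> tflip X (tanO X M) \<cdot> tanA X (tflip X M)
        = tflip X (tanO X M) \<cdot> tanA X (tflip X M) \<cdot> tflip X (tanO X M)"
    and tlift_tflip_tflip: "M \<in> Ob X \<Longrightarrow>
      tlift X (tanO X M) \<cdot> tanA X (tflip X M) \<cdot> tflip X (tanO X M)
        = tflip X M \<cdot> tanA X (tlift X M)"
    and tlift_universal: "M \<in> Ob X \<Longrightarrow> universal_lift X (tangent_bundle X M)"


section \<open>Display maps and differential bundles\<close>

definition tangent_display :: "('o, 'a, 'm) tangent_data_scheme \<Rightarrow> 'a \<Rightarrow> bool" where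
  "tangent_display X q \<longleftrightarrow> q \<in> Ar X \<and>
     (\<forall>n. \<forall>f \<in> Ar X. Cod X f = (tanO X ^^ n) (Cod X q) \<longrightarrow>
        (\<exists>a b. tangent_pullback X a b ((tanA X ^^ n) q) f))"

definition differential_bundle :: "('o, 'a, 'm) tangent_data_scheme \<Rightarrow> 'a bundle_data \<Rightarrow> bool" where
  "differential_bundle X B \<longleftrightarrow> (let q = bproj B; E = Dom X q; M = Cod X q in
     tangent_display X q \<and>
     has_tangent_fibre_powers X q \<and>
     tangent_pullback X (bfst B) (bsnd B) q q \<and>
     additive_bundle X B \<and>
     additive_morphism X B (T_bundle X B) (tzero X M) (blift B) \<and>
     additive_morphism X B (tangent_bundle X E) (bzero B) (blift B) \<and>
     blift B \<cdot> tlift X E = blift B \<cdot> tanA X (blift B) \<and>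
     universal_lift X B)" for X (structure)

text \<open>Again \<open>f\<close> is the morphism between the bases and \<open>g\<close> the one between the total objects.\<close>

definition linear_morphism ::
  "('o, 'a, 'm) tangent_data_scheme \<Rightarrow> 'a bundle_data \<Rightarrow> 'a bundle_data \<Rightarrow> 'a \<Rightarrow> 'a \<Rightarrow> bool" where
  "linear_morphism X B B' f g \<longleftrightarrow>
     f \<in> hom X (Cod X (bproj B)) (Cod X (bproj B')) \<and>
     g \<in> hom X (Dom X (bproj B)) (Dom X (bproj B')) \<and>
     bproj B \<cdot> f = g \<cdot> bproj B' \<and>
     g \<cdot> blift B' = blift B \<cdot> tanA X g" for X (structure)

text \<open>The category of (display) differential bundles over \<open>E\<close> and linear morphisms over
  \<open>id\<^sub>E\<close>.  The hom-sets \<open>DB_hom\<close> are written down for arbitrary bundle data; they are those of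
  the category when both arguments are in \<open>DB_obj\<close>.\<close>

definition DB_obj :: "('o, 'a, 'm) tangent_data_scheme \<Rightarrow> 'o \<Rightarrow> 'a bundle_data set" where
  "DB_obj X E = {B. differential_bundle X B \<and> Cod X (bproj B) = E}"

definition DB_hom ::
  "('o, 'a, 'm) tangent_data_scheme \<Rightarrow> 'o \<Rightarrow> 'a bundle_data \<Rightarrow> 'a bundle_data \<Rightarrow> 'a set" where
  "DB_hom X E B B' = {g. Cod X (bproj B) = E \<and> Cod X (bproj B') = E \<and>
     linear_morphism X B B' (Id X E) g}"


section \<open>Vertical bundles, vertical connections and vertical connection forms\<close>

text \<open>\<open>vertical_bundle X q V \<iota> \<tau>\<close>: the bundle data \<open>V\<close> over \<open>E = Dom q\<close>, with \<open>\<iota> = \<iota>\<^sub>q\<close> from the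
  total object to \<open>TE\<close> and \<open>\<tau> = T\<^sup>Vq\<close> from the total object to \<open>M = Cod q\<close>, is the vertical
  bundle of \<open>q\<close>.  The zero, sum and lift are determined by the equations because \<open>\<iota>\<close> and
  \<open>T\<iota>\<close> are monic, as pullbacks of the split monomorphisms \<open>z\<^sub>M\<close> and \<open>Tz\<^sub>M\<close>.\<close>

definition vertical_bundle ::
  "('o, 'a, 'm) tangent_data_scheme \<Rightarrow> 'a \<Rightarrow> 'a bundle_data \<Rightarrow> 'a \<Rightarrow> 'a \<Rightarrow> bool" where
  "vertical_bundle X q V \<iota> \<tau> \<longleftrightarrow> (let E = Dom X q; Vq = Dom X \<iota> in
     tangent_pullback X \<iota> \<tau> (tanA X q) (tzero X (Cod X q)) \<and>
     bproj V = \<iota> \<cdot> tproj X E \<and>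
     tangent_pullback X (bfst V) (bsnd V) (bproj V) (bproj V) \<and>
     bzero V \<in> hom X E Vq \<and> bzero V \<cdot> \<iota> = tzero X E \<and>
     bsum V \<in> hom X (Dom X (bfst V)) Vq \<and>
     bsum V \<cdot> \<iota> = badd X (tangent_bundle X E) (bfst V \<cdot> \<iota>) (bsnd V \<cdot> \<iota>) \<and>
     blift V \<in> hom X Vq (tanO X Vq) \<and> blift V \<cdot> tanA X \<iota> = \<iota> \<cdot> tlift X E)" for X (structure)

definition vertical_connection ::
  "('o, 'a, 'm) tangent_data_scheme \<Rightarrow> 'a \<Rightarrow> 'a bundle_data \<Rightarrow> 'a \<Rightarrow> 'a \<Rightarrow> bool" where
  "vertical_connection X q V \<iota> R \<longleftrightarrow> (let E = Dom X q in
     R \<in> hom X (tanO X E) (Dom X \<iota>) \<and>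
     \<iota> \<cdot> R = Id X (Dom X \<iota>) \<and>
     linear_morphism X (tangent_bundle X E) V (Id X E) R)" for X (structure)

definition vertical_connection_form ::
  "('o, 'a, 'm) tangent_data_scheme \<Rightarrow> 'a \<Rightarrow> 'a \<Rightarrow> 'a \<Rightarrow> bool" where
  "vertical_connection_form X q \<iota> \<phi> \<longleftrightarrow> (let E = Dom X q; M = Cod X q in
     \<phi> \<in> hom X (tanO X E) (tanO X E) \<and>
     \<iota> \<cdot> \<phi> = \<iota> \<and>
     linear_morphism X (tangent_bundle X E) (tangent_bundle X E) (Id X E) \<phi> \<and>
     \<phi> \<cdot> tanA X q = tproj X E \<cdot> q \<cdot> tzero X M)" for X (structure)

text \<open>The defining property of \<open>R\<^sub>\<phi>\<close>.\<close>

definition induces_form ::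
  "('o, 'a, 'm) tangent_data_scheme \<Rightarrow> 'a \<Rightarrow> 'a bundle_data \<Rightarrow> 'a \<Rightarrow> 'a \<Rightarrow> 'a \<Rightarrow> bool" where
  "induces_form X q V \<iota> \<phi> R \<longleftrightarrow>
     R \<in> DB_hom X (Dom X q) (tangent_bundle X (Dom X q)) V \<and>
     R \<cdot> \<iota> = \<phi> \<and> R \<cdot> bproj V = tproj X (Dom X q)" for X (structure)

definition R_of_form ::
  "('o, 'a, 'm) tangent_data_scheme \<Rightarrow> 'a \<Rightarrow> 'a bundle_data \<Rightarrow> 'a \<Rightarrow> 'a \<Rightarrow> 'a" where
  "R_of_form X q V \<iota> \<phi> = (THE R. induces_form X q V \<iota> \<phi> R)"

end

theory Submission
  imports Defs
begin

text \<open>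
  A vertical connection \<open>R\<close> is the same thing as its composite with \<open>\<iota>\<close> because \<open>\<iota>\<close> and \<open>T\<iota>\<close> are
  monic, being pullbacks of the split monomorphisms \<open>z\<^sub>M\<close> and \<open>Tz\<^sub>M\<close>.  Hence linearity of \<open>R\<close>
  can be tested after composing with \<open>T\<iota>\<close> (\<open>linear_iff_linear_form\<close>), and \<open>\<iota> R = id\<close> amounts to
  \<open>\<iota> R \<iota> = \<iota>\<close>.  A form \<open>\<phi>\<close> factors through \<open>\<iota>\<close> precisely because \<open>\<phi>\<close> followed by \<open>Tq\<close>
  factors through \<open>z\<^sub>M\<close> (\<open>connection_of_form\<close>); conversely \<open>\<tau> = \<iota> p q\<close> turns \<open>R q\<^sup>V = p\<close> into that
  condition (\<open>form_of_connection\<close>).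

  The substantial part is that the vertical bundle is a differential bundle.  Its additive and lift
  axioms are inherited from the tangent bundle \<open>p\<^sub>E\<close> along the monomorphism \<open>\<iota>\<close>: additive
  structure and additivity of morphisms are reflected by monomorphisms
  (\<open>additive_bundle_reflect\<close>, \<open>additive_morphism_reflect\<close>).  Its fibre powers are obtained by
  iterating pullbacks along a display map (\<open>display_fibre_powers\<close>).

  The universality of its lift (\<open>V_universal\<close>) is proved by pasting tangent pullbacks.  The map
  \<open>\<xi>\<close> is natural in linear additive morphisms (\<open>xi_natural\<close>), so \<open>\<xi>\<^sub>V\<close> followed by \<open>T\<iota>\<close> is
  \<open>\<iota> \<times> \<iota>\<close> followed by \<open>\<xi>\<^sub>E\<close>.  This last square is itself a pullback: \<open>V\<^sub>2\<close> is the pullback of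
  \<open>T\<^sub>2q\<close> along \<open>\<langle>z\<^sub>M, z\<^sub>M\<rangle>\<close>, the latter is the pullback of \<open>Tz\<^sub>M\<close> along \<open>\<xi>\<^sub>M\<close> by universality of
  \<open>l\<^sub>M\<close>, and \<open>TVq\<close> is the pullback of \<open>TTq\<close> along \<open>Tz\<^sub>M\<close>.  Pasting it with the universal square
  of \<open>l\<^sub>E\<close> gives the universal square of the vertical lift.
\<close>

section \<open>Categories and pullbacks\<close>

context category
begin

lemma in_hom_iff: "f \<in> hom C A B \<longleftrightarrow> f \<in> Ar C \<and> Dom C f = A \<and> Cod C f = B"
  by (simp add: hom_def)

lemma Comp_arrow [simp]:
  assumes "f \<in> Ar C" "g \<in> Ar C" "Cod C f = Dom C g"
  shows "f \<cdot> g \<in> Ar C" "Dom C (f \<cdot> g) = Dom C f" "Cod C (f \<cdot> g) = Cod C g"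
  using Comp_in_hom[of f "Dom C f" "Cod C f" g "Cod C g"] assms by (auto simp: hom_def)

lemma Id_arrow [simp]:
  assumes "A \<in> Ob C"
  shows "Id C A \<in> Ar C" "Dom C (Id C A) = A" "Cod C (Id C A) = A"
  using Id_in_hom[OF assms] by (auto simp: hom_def)

lemma arrow_Ob [simp]: "f \<in> Ar C \<Longrightarrow> Dom C f \<in> Ob C" "f \<in> Ar C \<Longrightarrow> Cod C f \<in> Ob C"
  by (auto intro: Dom_in_Ob Cod_in_Ob)

lemma Comp_Id [simp]:
  "f \<in> Ar C \<Longrightarrow> Dom C f = A \<Longrightarrow> Id C A \<cdot> f = f"
  "f \<in> Ar C \<Longrightarrow> Cod C f = B \<Longrightarrow> f \<cdot> Id C B = f"
  by (auto intro: Id_left Id_right simp: hom_def)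

lemma Comp_assoc' [simp]:
  assumes "f \<in> Ar C" "g \<in> Ar C" "h \<in> Ar C" "Cod C f = Dom C g" "Cod C g = Dom C h"
  shows "(f \<cdot> g) \<cdot> h = f \<cdot> (g \<cdot> h)"
  using Comp_assoc[of f "Dom C f" "Cod C f" g "Cod C g" h "Cod C h"] assms by (auto simp: hom_def)

text \<open>An equation between composites, in the form in which it rewrites inside a longer
  composite that is bracketed to the right.\<close>

lemma Comp_extend:
  assumes "a \<cdot> b = c" "a \<in> Ar C" "b \<in> Ar C" "w \<in> Ar C" "Cod C a = Dom C b" "Cod C b = Dom C w"
  shows "a \<cdot> (b \<cdot> w) = c \<cdot> w"
  using Comp_assoc'[of a b w] assms by simp

text \<open>With domains and codomains as equations instead of membership in hom-sets, rewriting can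
  discharge all typing conditions.\<close>

lemma is_pullback_iff:
  "is_pullback C a b f g \<longleftrightarrow>
     a \<in> Ar C \<and> b \<in> Ar C \<and> f \<in> Ar C \<and> g \<in> Ar C \<and> Dom C b = Dom C a \<and>
     Cod C a = Dom C f \<and> Cod C b = Dom C g \<and> Cod C g = Cod C f \<and> a \<cdot> f = b \<cdot> g \<and>
     (\<forall>h k. h \<in> Ar C \<longrightarrow> k \<in> Ar C \<longrightarrow> Dom C k = Dom C h \<longrightarrow> Cod C h = Dom C f \<longrightarrow>
        Cod C k = Dom C g \<longrightarrow> h \<cdot> f = k \<cdot> g \<longrightarrow>
        (\<exists>!u. u \<in> Ar C \<and> Dom C u = Dom C h \<and> Cod C u = Dom C a \<and> u \<cdot> a = h \<and> u \<cdot> b = k))" (is "_ = (_ \<and> _ \<and> _ \<and> _ \<and> _ \<and> _ \<and> _ \<and> _ \<and> _ \<and> ?U)")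
proof -
  have unquote: "(\<forall>N. \<forall>h \<in> hom C N A. \<forall>k \<in> hom C N B. R N h k) \<longleftrightarrow>
      (\<forall>h k. h \<in> Ar C \<longrightarrow> k \<in> Ar C \<longrightarrow> Dom C k = Dom C h \<longrightarrow> Cod C h = A \<longrightarrow>
        Cod C k = B \<longrightarrow> R (Dom C h) h k)" for A B R
    unfolding hom_def by auto
  have "is_pullback C a b f g \<longleftrightarrow> a \<in> hom C (Dom C a) (Dom C f) \<and> b \<in> hom C (Dom C a) (Dom C g) \<and>
     f \<in> hom C (Dom C f) (Cod C f) \<and> g \<in> hom C (Dom C g) (Cod C f) \<and>
     a \<cdot> f = b \<cdot> g \<and> ?U" unfolding is_pullback_def unquote unfolding hom_def mem_Collect_eq conj_assoc by (rule refl)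
  then show ?thesis by (simp only: hom_def mem_Collect_eq simp_thms conj_ac)
qed

lemma pullback_arrows:
  assumes "is_pullback C a b f g"
  shows "a \<in> Ar C" "b \<in> Ar C" "f \<in> Ar C" "g \<in> Ar C" "Dom C b = Dom C a"
    "Cod C a = Dom C f" "Cod C b = Dom C g" "Cod C g = Cod C f" "a \<cdot> f = b \<cdot> g"
  using assms unfolding is_pullback_iff by blast+

lemma pullback_factor:
  assumes "is_pullback C a b f g" "h \<in> Ar C" "k \<in> Ar C" "Dom C k = Dom C h"
    "Cod C h = Dom C f" "Cod C k = Dom C g" "h \<cdot> f = k \<cdot> g"
  obtains u where "u \<in> Ar C" "Dom C u = Dom C h" "Cod C u = Dom C a" "u \<cdot> a = h" "u \<cdot> b = k"
  using assms unfolding is_pullback_iff by blast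

lemma pullback_ext:
  assumes P: "is_pullback C a b f g" and u: "u \<in> Ar C" "Cod C u = Dom C a"
    and v: "v \<in> Ar C" "Dom C v = Dom C u" "Cod C v = Dom C a"
    and eq: "u \<cdot> a = v \<cdot> a" "u \<cdot> b = v \<cdot> b"
  shows "u = v"
proof -
  note p = pullback_arrows[OF P]
  have "(u \<cdot> a) \<cdot> f = (u \<cdot> b) \<cdot> g" using p u by simp
  then have "\<exists>!w. w \<in> Ar C \<and> Dom C w = Dom C (u \<cdot> a) \<and> Cod C w = Dom C a \<and>
      w \<cdot> a = u \<cdot> a \<and> w \<cdot> b = u \<cdot> b"
    using P p u unfolding is_pullback_iff by (metis Comp_arrow)
  moreover have "Dom C (u \<cdot> a) = Dom C u" using p u by simp
  ultimately show ?thesis using u v eq by metis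
qed

lemma pullbackI:
  assumes "a \<in> Ar C" "b \<in> Ar C" "f \<in> Ar C" "g \<in> Ar C" "Dom C b = Dom C a"
    "Cod C a = Dom C f" "Cod C b = Dom C g" "Cod C g = Cod C f" "a \<cdot> f = b \<cdot> g"
    and ex: "\<And>h k. h \<in> Ar C \<Longrightarrow> k \<in> Ar C \<Longrightarrow> Dom C k = Dom C h \<Longrightarrow> Cod C h = Dom C f \<Longrightarrow>
        Cod C k = Dom C g \<Longrightarrow> h \<cdot> f = k \<cdot> g \<Longrightarrow>
        \<exists>u. u \<in> Ar C \<and> Dom C u = Dom C h \<and> Cod C u = Dom C a \<and> u \<cdot> a = h \<and> u \<cdot> b = k"
    and un: "\<And>u v. u \<in> Ar C \<Longrightarrow> v \<in> Ar C \<Longrightarrow> Dom C v = Dom C u \<Longrightarrow> Cod C u = Dom C a \<Longrightarrow>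
        Cod C v = Dom C a \<Longrightarrow> u \<cdot> a = v \<cdot> a \<Longrightarrow> u \<cdot> b = v \<cdot> b \<Longrightarrow> u = v"
  shows "is_pullback C a b f g"
  unfolding is_pullback_iff
proof (intro conjI allI impI)
  fix h k
  assume hk: "h \<in> Ar C" "k \<in> Ar C" "Dom C k = Dom C h" "Cod C h = Dom C f"
    "Cod C k = Dom C g" "h \<cdot> f = k \<cdot> g"
  show "\<exists>!u. u \<in> Ar C \<and> Dom C u = Dom C h \<and> Cod C u = Dom C a \<and> u \<cdot> a = h \<and> u \<cdot> b = k"
    using ex[OF hk] un by (metis (full_types))
qed (use assms in auto)

lemma pullback_sym: "is_pullback C a b f g \<Longrightarrow> is_pullback C b a g f"
  unfolding is_pullback_iff by (smt (verit))

lemma pullback_paste: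
  assumes P: "is_pullback C a b f g" and Q: "is_pullback C c d e a"
  shows "is_pullback C c (d \<cdot> b) (e \<cdot> f) g"
proof -
  note p = pullback_arrows[OF P] and q = pullback_arrows[OF Q]
  note pe = Comp_extend[OF p(9)] and qe = Comp_extend[OF q(9)]
  show ?thesis
  proof (rule pullbackI)
    show "c \<cdot> (e \<cdot> f) = (d \<cdot> b) \<cdot> g" using p q by (simp add: qe)
  next
    fix h k
    assume hk: "h \<in> Ar C" "k \<in> Ar C" "Dom C k = Dom C h" "Cod C h = Dom C (e \<cdot> f)"
      "Cod C k = Dom C g" "h \<cdot> (e \<cdot> f) = k \<cdot> g"
    obtain v where v: "v \<in> Ar C" "Dom C v = Dom C (h \<cdot> e)" "Cod C v = Dom C a"
        "v \<cdot> a = h \<cdot> e" "v \<cdot> b = k"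
      by (rule pullback_factor[OF P, of "h \<cdot> e" k]) (use hk p q in auto)
    obtain u where u: "u \<in> Ar C" "Dom C u = Dom C h" "Cod C u = Dom C c"
        "u \<cdot> c = h" "u \<cdot> d = v"
      by (rule pullback_factor[OF Q, of h v]) (use hk p q v in auto)
    have "u \<cdot> (d \<cdot> b) = k" using u v p q by (simp add: Comp_extend[OF u(5)])
    then show "\<exists>u. u \<in> Ar C \<and> Dom C u = Dom C h \<and> Cod C u = Dom C c \<and> u \<cdot> c = h \<and> u \<cdot> (d \<cdot> b) = k"
      using u by blast
  next
    fix u v
    assume uv: "u \<in> Ar C" "v \<in> Ar C" "Dom C v = Dom C u" "Cod C u = Dom C c"
      "Cod C v = Dom C c" "u \<cdot> c = v \<cdot> c" "u \<cdot> (d \<cdot> b) = v \<cdot> (d \<cdot> b)"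
    have eq: "u \<cdot> d = v \<cdot> d"
    proof (rule pullback_ext[OF P])
      have "u \<cdot> (c \<cdot> e) = v \<cdot> (c \<cdot> e)" using uv q Comp_extend[OF uv(6), of e] by simp
      then show "(u \<cdot> d) \<cdot> a = (v \<cdot> d) \<cdot> a" using uv p q by simp
    qed (use uv p q in auto)
    show "u = v" by (rule pullback_ext[OF Q]) (use eq uv p q in auto)
  qed (use p q in auto)
qed

lemma pullback_cancel:
  assumes P: "is_pullback C a b f g" and Q: "is_pullback C c (d \<cdot> b) (e \<cdot> f) g"
    and d: "d \<in> Ar C" "Dom C d = Dom C c" "Cod C d = Dom C a"
    and e: "e \<in> Ar C" "Dom C e = Cod C c" "Cod C e = Cod C a"
    and eq: "c \<cdot> e = d \<cdot> a"
  shows "is_pullback C c d e a"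
proof -
  note p = pullback_arrows[OF P] and q = pullback_arrows[OF Q]
  show ?thesis
  proof (rule pullbackI)
    fix h k
    assume hk: "h \<in> Ar C" "k \<in> Ar C" "Dom C k = Dom C h" "Cod C h = Dom C e"
      "Cod C k = Dom C a" "h \<cdot> e = k \<cdot> a"
    have sq: "h \<cdot> (e \<cdot> f) = (k \<cdot> b) \<cdot> g"
      using hk d e p by (simp add: Comp_extend[OF hk(6)])
    obtain u where u: "u \<in> Ar C" "Dom C u = Dom C h" "Cod C u = Dom C c"
        "u \<cdot> c = h" "u \<cdot> (d \<cdot> b) = k \<cdot> b"
      by (rule pullback_factor[OF Q _ _ _ _ _ sq]) (use hk d e p in auto)
    have "u \<cdot> d = k"
    proof (rule pullback_ext[OF P])
      have "u \<cdot> (c \<cdot> e) = h \<cdot> e" using u q e hk Comp_extend[OF u(4), of e] by simp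
      then show "(u \<cdot> d) \<cdot> a = k \<cdot> a" using hk u p d e eq by simp
    qed (use hk u d p in auto)
    then show "\<exists>u. u \<in> Ar C \<and> Dom C u = Dom C h \<and> Cod C u = Dom C c \<and> u \<cdot> c = h \<and> u \<cdot> d = k"
      using u by blast
  next
    fix u v
    assume uv: "u \<in> Ar C" "v \<in> Ar C" "Dom C v = Dom C u" "Cod C u = Dom C c"
      "Cod C v = Dom C c" "u \<cdot> c = v \<cdot> c" "u \<cdot> d = v \<cdot> d"
    have eq': "u \<cdot> (d \<cdot> b) = v \<cdot> (d \<cdot> b)" using uv d p by (simp add: Comp_extend[OF uv(7)])
    show "u = v" by (rule pullback_ext[OF Q]) (use uv eq' in auto)
  qed (use p q d e eq in auto)
qed

lemma pullback_Id:
  assumes "f \<in> Ar C"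
  shows "is_pullback C f (Id C (Dom C f)) (Id C (Cod C f)) f"
proof (rule pullbackI)
  fix h k
  assume hk: "h \<in> Ar C" "k \<in> Ar C" "Dom C k = Dom C h" "Cod C h = Dom C (Id C (Cod C f))"
    "Cod C k = Dom C f" "h \<cdot> Id C (Cod C f) = k \<cdot> f"
  show "\<exists>u. u \<in> Ar C \<and> Dom C u = Dom C h \<and> Cod C u = Dom C f \<and> u \<cdot> f = h \<and> u \<cdot> Id C (Dom C f) = k"
    by (rule exI[of _ k]) (use hk assms in auto)
qed (use assms in auto)

text \<open>The second component of a map into the pullback is determined by the first, through a
  retraction of \<open>z\<close>.\<close>

lemma pullback_split_mono:
  assumes P: "is_pullback C i t f z" and r: "r \<in> Ar C" "Dom C r = Cod C z" "z \<cdot> r = Id C (Dom C z)"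
    and u: "u \<in> Ar C" "Cod C u = Dom C i" and v: "v \<in> Ar C" "Dom C v = Dom C u" "Cod C v = Dom C i"
    and eq: "u \<cdot> i = v \<cdot> i"
  shows "u = v"
proof (rule pullback_ext[OF P u v eq])
  note p = pullback_arrows[OF P]
  have "w \<cdot> t = w \<cdot> i \<cdot> f \<cdot> r" if "w \<in> Ar C" "Cod C w = Dom C i" for w
  proof -
    have "w \<cdot> i \<cdot> f \<cdot> r = w \<cdot> (t \<cdot> (z \<cdot> r))"
      using that p r(1,2) by (simp add: Comp_extend[OF p(9)])
    then show ?thesis using that p r by simp
  qed
  then show "u \<cdot> t = v \<cdot> t" using u v eq by simp
qed

lemma pairing_works:
  assumes "is_pullback C a b f g" "h \<in> Ar C" "k \<in> Ar C" "Dom C k = Dom C h"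
    "Cod C h = Dom C f" "Cod C k = Dom C g" "h \<cdot> f = k \<cdot> g"
  shows "pairing C a b h k \<in> Ar C" "Dom C (pairing C a b h k) = Dom C h"
    "Cod C (pairing C a b h k) = Dom C a"
    "pairing C a b h k \<cdot> a = h" "pairing C a b h k \<cdot> b = k"
proof -
  have "\<exists>!u. u \<in> hom C (Dom C h) (Dom C a) \<and> u \<cdot> a = h \<and> u \<cdot> b = k"
    using assms unfolding is_pullback_iff hom_def by auto
  from theI'[OF this] show "pairing C a b h k \<in> Ar C" "Dom C (pairing C a b h k) = Dom C h"
    "Cod C (pairing C a b h k) = Dom C a"
    "pairing C a b h k \<cdot> a = h" "pairing C a b h k \<cdot> b = k"
    unfolding pairing_def hom_def by auto
qed

lemma pairing_eqI:
  assumes P: "is_pullback C a b f g" and u: "u \<in> Ar C" "Cod C u = Dom C a"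
  shows "pairing C a b (u \<cdot> a) (u \<cdot> b) = u"
proof -
  note p = pullback_arrows[OF P]
  note w = pairing_works[OF P, of "u \<cdot> a" "u \<cdot> b"]
  show ?thesis by (rule pullback_ext[OF P]) (use p u w in auto)
qed

text \<open>The new projection is put last, at index \<open>n\<close>.\<close>

lemma fibre_power_Suc:
  assumes F: "is_fibre_power C n q b \<pi>" and P: "is_pullback C c d q b"
  shows "is_fibre_power C (Suc n) q (d \<cdot> b) (\<lambda>i. if i < n then d \<cdot> \<pi> i else c)"
proof -
  note p = pullback_arrows[OF P]
  have \<pi>: "\<pi> i \<in> Ar C" "Dom C (\<pi> i) = Dom C b" "Cod C (\<pi> i) = Dom C q" "\<pi> i \<cdot> q = b" if "i < n" for i
    using F that unfolding is_fibre_power_def hom_def by auto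
  have ex1: "\<exists>!u. u \<in> hom C N (Dom C b) \<and> u \<cdot> b = k \<and> (\<forall>i<n. u \<cdot> \<pi> i = \<rho> i)"
    if "k \<in> hom C N (Cod C q)" "\<forall>i<n. \<rho> i \<in> hom C N (Dom C q) \<and> \<rho> i \<cdot> q = k" for N \<rho> k
    using F that unfolding is_fibre_power_def by blast
  show ?thesis
    unfolding is_fibre_power_def
  proof (intro conjI allI ballI impI)
    fix N \<rho> k
    assume k: "k \<in> hom C N (Cod C q)"
      and \<rho>: "\<forall>i<Suc n. \<rho> i \<in> hom C N (Dom C q) \<and> \<rho> i \<cdot> q = k"
    have E: "\<exists>!v. v \<in> hom C N (Dom C b) \<and> v \<cdot> b = k \<and> (\<forall>i<n. v \<cdot> \<pi> i = \<rho> i)"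
      by (rule ex1[OF k]) (use \<rho> in auto)
    then obtain v where v: "v \<in> hom C N (Dom C b)" "v \<cdot> b = k" "\<And>i. i < n \<Longrightarrow> v \<cdot> \<pi> i = \<rho> i"
      by (elim ex1E conjE) blast
    have v_unique: "w = v" if "w \<in> hom C N (Dom C b)" "w \<cdot> b = k" "\<And>i. i < n \<Longrightarrow> w \<cdot> \<pi> i = \<rho> i" for w
      by (rule trans[OF the1_equality[OF E, symmetric] the1_equality[OF E]]) (use v that in auto)
    have \<rho>n: "\<rho> n \<in> Ar C" "Dom C (\<rho> n) = N" "Cod C (\<rho> n) = Dom C q" "\<rho> n \<cdot> q = k"
      using \<rho> by (auto simp: hom_def)
    have v': "v \<in> Ar C" "Dom C v = N" "Cod C v = Dom C b" using v by (auto simp: hom_def)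
    obtain u where u: "u \<in> Ar C" "Dom C u = Dom C (\<rho> n)" "Cod C u = Dom C c" "u \<cdot> c = \<rho> n" "u \<cdot> d = v"
      by (rule pullback_factor[OF P, of "\<rho> n" v]) (use \<rho>n v v' in auto)
    show "\<exists>!u. u \<in> hom C N (Dom C (d \<cdot> b)) \<and> u \<cdot> (d \<cdot> b) = k \<and>
        (\<forall>i<Suc n. u \<cdot> (if i < n then d \<cdot> \<pi> i else c) = \<rho> i)"
    proof (intro ex1I[of _ u] conjI allI impI)
      show "u \<in> hom C N (Dom C (d \<cdot> b))" using u \<rho>n p by (simp add: hom_def)
      show "u \<cdot> (d \<cdot> b) = k" using u p v by (simp add: Comp_extend[OF u(5)])
      fix i assume i: "i < Suc n"
      show "u \<cdot> (if i < n then d \<cdot> \<pi> i else c) = \<rho> i"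
      proof (cases "i < n")
        case True
        then show ?thesis using u p \<pi> v by (simp add: Comp_extend[OF u(5)])
      next
        case False
        then have "i = n" using i by simp
        then show ?thesis using u by simp
      qed
    next
      fix w
      assume w: "w \<in> hom C N (Dom C (d \<cdot> b)) \<and> w \<cdot> (d \<cdot> b) = k \<and>
        (\<forall>i<Suc n. w \<cdot> (if i < n then d \<cdot> \<pi> i else c) = \<rho> i)"
      then have w1: "w \<in> Ar C" "Dom C w = N" "Cod C w = Dom C c" "w \<cdot> (d \<cdot> b) = k"
        using p by (auto simp: hom_def)
      have w2: "w \<cdot> c = \<rho> n" using w by auto
      have w3: "w \<cdot> (d \<cdot> \<pi> i) = \<rho> i" if "i < n" for i using w that by (auto dest: spec[of _ i])
      have "w \<cdot> d = v"
        by (rule v_unique) (use w1 w3 p \<pi> in \<open>auto simp: hom_def\<close>)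
      then show "w = u" using pullback_ext[OF P, of w u] w1 w2 u \<rho>n by simp
    qed
  qed (use p \<pi> in \<open>auto simp: hom_def Comp_extend[OF p(9)]\<close>)
qed

text \<open>For \<open>i\<close>, \<open>t\<close> the inclusion and base projection of a vertical bundle, \<open>F = T\<^sub>2q\<close> and
  \<open>W = \<langle>z, z\<rangle>\<close>, this identifies \<open>V\<^sub>2\<close> with the pullback of \<open>T\<^sub>2q\<close> along \<open>W\<close>: a pair of tangent
  vectors at the same point of \<open>E\<close>, both sent to zero, is a pair of vertical vectors over
  that point.  The common value of \<open>v1 t\<close> and \<open>v2 t\<close> comes from \<open>t = i p q\<close>.  The maps \<open>j\<close>, \<open>F\<close>, \<open>W\<close>
  are described by equations, and not as pairings, so that the statement applies verbatim to images
  under powers of \<open>T\<close>.\<close>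

lemma pullback_fibre_square:
  assumes V: "is_pullback C i t f z"
    and V2: "is_pullback C v1 v2 (i \<cdot> p) (i \<cdot> p)"
    and E2: "is_pullback C e1 e2 p p"
    and M2: "is_pullback C m1 m2 p' p'"
    and j: "j \<in> Ar C" "Dom C j = Dom C v1" "Cod C j = Dom C e1" "j \<cdot> e1 = v1 \<cdot> i" "j \<cdot> e2 = v2 \<cdot> i"
    and F: "F \<in> Ar C" "Dom C F = Dom C e1" "Cod C F = Dom C m1" "F \<cdot> m1 = e1 \<cdot> f" "F \<cdot> m2 = e2 \<cdot> f"
    and W: "W \<in> Ar C" "Dom C W = Dom C z" "Cod C W = Dom C m1" "W \<cdot> m1 = z" "W \<cdot> m2 = z"
    and q: "q \<in> Ar C" "Dom C q = Cod C p" "f \<cdot> p' = p \<cdot> q" "z \<cdot> p' = Id C (Dom C z)"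
    and ty: "Cod C i = Dom C p" "Cod C f = Dom C p'" "Cod C p' = Dom C z"
  shows "is_pullback C j (v1 \<cdot> t) F W"
proof -
  note v = pullback_arrows[OF V] and v2 = pullback_arrows[OF V2]
  note e = pullback_arrows[OF E2] and m = pullback_arrows[OF M2]
  note arr = v v2(1-8) e m j F W q ty
  have t: "t = i \<cdot> (p \<cdot> q)"
  proof -
    have "i \<cdot> (f \<cdot> p') = t \<cdot> (z \<cdot> p')" using v m ty by (simp add: Comp_extend[OF v(9)])
    then show ?thesis using v m q by simp
  qed
  have vt: "v1 \<cdot> t = v2 \<cdot> t"
    unfolding t using arr Comp_extend[OF v2(9), of q] by simp
  show ?thesis
  proof (rule pullbackI)
    show "j \<cdot> F = (v1 \<cdot> t) \<cdot> W"
    proof (rule pullback_ext[OF M2])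
      show "(j \<cdot> F) \<cdot> m1 = ((v1 \<cdot> t) \<cdot> W) \<cdot> m1"
        using arr by (simp add: Comp_extend[OF j(4)])
      have "v2 \<cdot> (t \<cdot> z) = v1 \<cdot> (t \<cdot> z)" using arr Comp_extend[OF vt, of z] by simp
      then show "(j \<cdot> F) \<cdot> m2 = ((v1 \<cdot> t) \<cdot> W) \<cdot> m2"
        using arr by (simp add: Comp_extend[OF j(5)])
    qed (use arr in auto)
  next
    fix h k
    assume hk: "h \<in> Ar C" "k \<in> Ar C" "Dom C k = Dom C h" "Cod C h = Dom C F"
      "Cod C k = Dom C W" "h \<cdot> F = k \<cdot> W"
    have 1: "h \<cdot> (e1 \<cdot> f) = k \<cdot> z"
      using arr hk Comp_extend[OF hk(6), of m1] by simp
    have 2: "h \<cdot> (e2 \<cdot> f) = k \<cdot> z"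
      using arr hk Comp_extend[OF hk(6), of m2] by simp
    obtain w1 where w1: "w1 \<in> Ar C" "Dom C w1 = Dom C (h \<cdot> e1)" "Cod C w1 = Dom C i"
        "w1 \<cdot> i = h \<cdot> e1" "w1 \<cdot> t = k"
      by (rule pullback_factor[OF V, of "h \<cdot> e1" k]) (use arr hk 1 in auto)
    obtain w2 where w2: "w2 \<in> Ar C" "Dom C w2 = Dom C (h \<cdot> e2)" "Cod C w2 = Dom C i"
        "w2 \<cdot> i = h \<cdot> e2" "w2 \<cdot> t = k"
      by (rule pullback_factor[OF V, of "h \<cdot> e2" k]) (use arr hk 2 in auto)
    obtain u where u: "u \<in> Ar C" "Dom C u = Dom C w1" "Cod C u = Dom C v1"
        "u \<cdot> v1 = w1" "u \<cdot> v2 = w2"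
      by (rule pullback_factor[OF V2, of w1 w2])
        (use arr hk w1 w2 in \<open>auto simp: Comp_extend[OF w1(4)] Comp_extend[OF w2(4)]\<close>)
    have "u \<cdot> j = h"
      by (rule pullback_ext[OF E2])
        (use arr hk w1 w2 u in \<open>auto simp: Comp_extend[OF u(4)] Comp_extend[OF u(5)]\<close>)
    moreover have "u \<cdot> (v1 \<cdot> t) = k" using arr u w1 by (simp add: Comp_extend[OF u(4)])
    ultimately show "\<exists>u. u \<in> Ar C \<and> Dom C u = Dom C h \<and> Cod C u = Dom C j \<and> u \<cdot> j = h \<and> u \<cdot> (v1 \<cdot> t) = k"
      using arr hk u w1 by auto
  next
    fix u u'
    assume u: "u \<in> Ar C" "u' \<in> Ar C" "Dom C u' = Dom C u" "Cod C u = Dom C j"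
      "Cod C u' = Dom C j" "u \<cdot> j = u' \<cdot> j" "u \<cdot> (v1 \<cdot> t) = u' \<cdot> (v1 \<cdot> t)"
    have i1: "u \<cdot> (v1 \<cdot> i) = u' \<cdot> (v1 \<cdot> i)"
      using arr u Comp_extend[OF u(6), of e1] by simp
    have i2: "u \<cdot> (v2 \<cdot> i) = u' \<cdot> (v2 \<cdot> i)"
      using arr u Comp_extend[OF u(6), of e2] by simp
    have j1: "u \<cdot> v1 = u' \<cdot> v1" by (rule pullback_ext[OF V]) (use arr u i1 in auto)
    have j2: "u \<cdot> v2 = u' \<cdot> v2" by (rule pullback_ext[OF V]) (use arr u i2 vt in auto)
    show "u = u'" by (rule pullback_ext[OF V2]) (use arr u j1 j2 in auto)
  qed (use arr in auto)
qed

end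

section \<open>Tangent pullbacks\<close>

context tangent_category
begin

lemma tanA_arrow [simp]:
  assumes "f \<in> Ar X"
  shows "tanA X f \<in> Ar X" "Dom X (tanA X f) = tanO X (Dom X f)" "Cod X (tanA X f) = tanO X (Cod X f)"
  using tanA_in_hom[of f "Dom X f" "Cod X f"] assms by (auto simp: hom_def)

lemma tanA_Comp' [simp]:
  assumes "f \<in> Ar X" "g \<in> Ar X" "Cod X f = Dom X g"
  shows "tanA X (f \<cdot> g) = tanA X f \<cdot> tanA X g"
  using tanA_Comp[of f "Dom X f" "Cod X f" g "Cod X g"] assms by (auto simp: hom_def)

declare tanO_in_Ob [simp] tanA_Id [simp]

lemma tanA_pow_arrow [simp]:
  assumes "f \<in> Ar X"
  shows "(tanA X ^^ m) f \<in> Ar X" "Dom X ((tanA X ^^ m) f) = (tanO X ^^ m) (Dom X f)"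
    "Cod X ((tanA X ^^ m) f) = (tanO X ^^ m) (Cod X f)"
  using assms by (induction m) auto

lemma tanA_pow_Comp [simp]:
  assumes "f \<in> Ar X" "g \<in> Ar X" "Cod X f = Dom X g"
  shows "(tanA X ^^ m) (f \<cdot> g) = (tanA X ^^ m) f \<cdot> (tanA X ^^ m) g"
  using assms by (induction m) auto

lemma tanO_pow_Ob [simp]: "A \<in> Ob X \<Longrightarrow> (tanO X ^^ m) A \<in> Ob X"
  by (induction m) auto

lemma tanA_pow_Id [simp]: "A \<in> Ob X \<Longrightarrow> (tanA X ^^ m) (Id X A) = Id X ((tanO X ^^ m) A)"
  by (induction m) auto

lemma tangent_pullbackD: "tangent_pullback X a b f g \<Longrightarrow> is_pullback X a b f g"
  unfolding tangent_pullback_def by (metis funpow_0)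

lemma tangent_pullback_T:
  "tangent_pullback X a b f g \<Longrightarrow> tangent_pullback X (tanA X a) (tanA X b) (tanA X f) (tanA X g)"
  unfolding tangent_pullback_def by (metis comp_apply funpow_Suc_right)

lemma tangent_pullback_sym: "tangent_pullback X a b f g \<Longrightarrow> tangent_pullback X b a g f"
  unfolding tangent_pullback_def by (auto intro: pullback_sym)

lemma tangent_pullback_paste:
  assumes P: "tangent_pullback X a b f g" and Q: "tangent_pullback X c d e a"
  shows "tangent_pullback X c (d \<cdot> b) (e \<cdot> f) g"
  unfolding tangent_pullback_def
proof
  fix m
  note p = pullback_arrows[OF tangent_pullbackD[OF P]] and q = pullback_arrows[OF tangent_pullbackD[OF Q]]
  show "is_pullback X ((tanA X ^^ m) c) ((tanA X ^^ m) (d \<cdot> b)) ((tanA X ^^ m) (e \<cdot> f)) ((tanA X ^^ m) g)"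
    using pullback_paste[OF P[unfolded tangent_pullback_def, rule_format] Q[unfolded tangent_pullback_def, rule_format], of m]
      p q by simp
qed

lemma tangent_pullback_cancel:
  assumes P: "tangent_pullback X a b f g" and Q: "tangent_pullback X c (d \<cdot> b) (e \<cdot> f) g"
    and d: "d \<in> Ar X" "Dom X d = Dom X c" "Cod X d = Dom X a"
    and e: "e \<in> Ar X" "Dom X e = Cod X c" "Cod X e = Cod X a"
    and eq: "c \<cdot> e = d \<cdot> a"
  shows "tangent_pullback X c d e a"
  unfolding tangent_pullback_def
proof
  fix m
  note p = pullback_arrows[OF tangent_pullbackD[OF P]] and q = pullback_arrows[OF tangent_pullbackD[OF Q]]
  have "(tanA X ^^ m) c \<cdot> (tanA X ^^ m) e = (tanA X ^^ m) (c \<cdot> e)" using q e by simp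
  also have "\<dots> = (tanA X ^^ m) d \<cdot> (tanA X ^^ m) a" using p d by (simp add: eq)
  finally have eq': "(tanA X ^^ m) c \<cdot> (tanA X ^^ m) e = (tanA X ^^ m) d \<cdot> (tanA X ^^ m) a" .
  show "is_pullback X ((tanA X ^^ m) c) ((tanA X ^^ m) d) ((tanA X ^^ m) e) ((tanA X ^^ m) a)"
    by (rule pullback_cancel[OF P[unfolded tangent_pullback_def, rule_format, of m]])
      (use Q[unfolded tangent_pullback_def, rule_format, of m] p q d e eq' in auto)
qed

lemma tangent_pullback_Id:
  "f \<in> Ar X \<Longrightarrow> tangent_pullback X f (Id X (Dom X f)) (Id X (Cod X f)) f"
  unfolding tangent_pullback_def using pullback_Id[of "(tanA X ^^ m) f" for m] by simp

text \<open>The case \<open>n = 0\<close> of the display condition provides a tangent pullback of \<open>q\<close> along the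
  structure map of each fibre power, which is the next one.\<close>

lemma display_fibre_powers:
  assumes q: "tangent_display X q"
  shows "has_tangent_fibre_powers X q"
  unfolding has_tangent_fibre_powers_def
proof
  have q_ar: "q \<in> Ar X" using q unfolding tangent_display_def by simp
  fix n
  \<comment> \<open>Typing of the projections is carried along: it is needed to distribute powers of \<open>T\<close>.\<close>
  have "\<exists>b \<pi>. b \<in> Ar X \<and> Cod X b = Cod X q \<and> (\<forall>i<n. \<pi> i \<in> Ar X \<and> Dom X (\<pi> i) = Dom X b) \<and>
      (\<forall>m. is_fibre_power X n ((tanA X ^^ m) q) ((tanA X ^^ m) b) (\<lambda>i. (tanA X ^^ m) (\<pi> i)))"
  proof (induction n)
    case 0
    have "is_fibre_power X 0 ((tanA X ^^ m) q) ((tanA X ^^ m) (Id X (Cod X q))) (\<lambda>i. (tanA X ^^ m) (\<pi> i))" for m \<pi>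
      unfolding is_fibre_power_def using q_ar by (auto simp: hom_def)
    then show ?case using q_ar by (intro exI[of _ "Id X (Cod X q)"]) auto
  next
    case (Suc n)
    then obtain b \<pi> where b: "b \<in> Ar X" "Cod X b = Cod X q"
      and \<pi>: "\<And>i. i < n \<Longrightarrow> \<pi> i \<in> Ar X \<and> Dom X (\<pi> i) = Dom X b"
      and F: "\<And>m. is_fibre_power X n ((tanA X ^^ m) q) ((tanA X ^^ m) b) (\<lambda>i. (tanA X ^^ m) (\<pi> i))"
      by blast
    obtain c d where P: "tangent_pullback X c d q b"
      using q b unfolding tangent_display_def by (metis funpow_0)
    note p = pullback_arrows[OF tangent_pullbackD[OF P]]
    let ?\<pi> = "\<lambda>i. if i < n then d \<cdot> \<pi> i else c"
    have "is_fibre_power X (Suc n) ((tanA X ^^ m) q) ((tanA X ^^ m) (d \<cdot> b)) (\<lambda>i. (tanA X ^^ m) (?\<pi> i))" for m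
    proof -
      have "(\<lambda>i. (tanA X ^^ m) (?\<pi> i)) = (\<lambda>i. if i < n then (tanA X ^^ m) d \<cdot> (tanA X ^^ m) (\<pi> i) else (tanA X ^^ m) c)"
        using p \<pi> by auto
      then show ?thesis
        using fibre_power_Suc[OF F P[unfolded tangent_pullback_def, rule_format], of m] p by simp
    qed
    then show ?case
      using p \<pi> b by (intro exI[of _ "d \<cdot> b"] exI[of _ ?\<pi>]) auto
  qed
  then show "\<exists>b \<pi>. \<forall>m. is_fibre_power X n ((tanA X ^^ m) q) ((tanA X ^^ m) b) (\<lambda>i. (tanA X ^^ m) (\<pi> i))"
    by blast
qed

section \<open>Addition in bundles\<close>

text \<open>The part of a bundle needed to compute with sums.  It is preserved by \<open>T\<close>, and the
  vertical bundle has it by construction, before its monoid laws are established.\<close>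

definition fibrewise_sum :: "'a bundle_data \<Rightarrow> bool" where
  "fibrewise_sum B \<longleftrightarrow> tangent_pullback X (bfst B) (bsnd B) (bproj B) (bproj B) \<and>
     bsum B \<in> hom X (Dom X (bfst B)) (Dom X (bproj B))"

lemma fibrewise_sum_arrows:
  assumes "fibrewise_sum B"
  shows "is_pullback X (bfst B) (bsnd B) (bproj B) (bproj B)"
    "bfst B \<in> Ar X" "bsnd B \<in> Ar X" "bproj B \<in> Ar X" "bsum B \<in> Ar X"
    "Cod X (bfst B) = Dom X (bproj B)" "Cod X (bsnd B) = Dom X (bproj B)"
    "Dom X (bsnd B) = Dom X (bfst B)" "Dom X (bsum B) = Dom X (bfst B)"
    "Cod X (bsum B) = Dom X (bproj B)" "bfst B \<cdot> bproj B = bsnd B \<cdot> bproj B"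
  using assms pullback_arrows[OF tangent_pullbackD[of "bfst B" "bsnd B" "bproj B" "bproj B"]]
  unfolding fibrewise_sum_def hom_def by (auto intro: tangent_pullbackD)

lemma badd_arrow:
  assumes "fibrewise_sum B" "x \<in> Ar X" "y \<in> Ar X" "Dom X y = Dom X x"
    "Cod X x = Dom X (bproj B)" "Cod X y = Dom X (bproj B)" "x \<cdot> bproj B = y \<cdot> bproj B"
  shows "badd X B x y \<in> Ar X" "Dom X (badd X B x y) = Dom X x"
    "Cod X (badd X B x y) = Dom X (bproj B)"
  using pairing_works[OF fibrewise_sum_arrows(1)[OF assms(1)] assms(2-7)] fibrewise_sum_arrows[OF assms(1)]
  unfolding badd_def by auto

lemma badd_Comp:
  assumes "fibrewise_sum B" "u \<in> Ar X" "Cod X u = Dom X (bfst B)"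
  shows "badd X B (u \<cdot> bfst B) (u \<cdot> bsnd B) = u \<cdot> bsum B"
  unfolding badd_def using pairing_eqI[OF fibrewise_sum_arrows(1)[OF assms(1)] assms(2,3)] by simp

text \<open>All computations with sums go through the map into the chosen \<open>E\<^sub>2\<close> that classifies the two
  summands.\<close>

lemma badd_factor:
  assumes "fibrewise_sum B" "x \<in> Ar X" "y \<in> Ar X" "Dom X y = Dom X x"
    "Cod X x = Dom X (bproj B)" "Cod X y = Dom X (bproj B)" "x \<cdot> bproj B = y \<cdot> bproj B"
  obtains u where "u \<in> Ar X" "Dom X u = Dom X x" "Cod X u = Dom X (bfst B)"
    "u \<cdot> bfst B = x" "u \<cdot> bsnd B = y" "badd X B x y = u \<cdot> bsum B"
  using pairing_works[OF fibrewise_sum_arrows(1)[OF assms(1)] assms(2-7)] that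
  unfolding badd_def by blast

lemma badd_precomp:
  assumes B: "fibrewise_sum B" and x: "x \<in> Ar X" "y \<in> Ar X" "Dom X y = Dom X x"
    "Cod X x = Dom X (bproj B)" "Cod X y = Dom X (bproj B)" "x \<cdot> bproj B = y \<cdot> bproj B"
    and w: "w \<in> Ar X" "Cod X w = Dom X x"
  shows "w \<cdot> badd X B x y = badd X B (w \<cdot> x) (w \<cdot> y)"
proof -
  note b = fibrewise_sum_arrows[OF B]
  obtain u where u: "u \<in> Ar X" "Dom X u = Dom X x" "Cod X u = Dom X (bfst B)"
    "u \<cdot> bfst B = x" "u \<cdot> bsnd B = y" "badd X B x y = u \<cdot> bsum B"
    by (rule badd_factor[OF B x])
  show ?thesis using badd_Comp[OF B, of "w \<cdot> u"] u w b by simp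
qed

lemma badd_proj:
  assumes B: "fibrewise_sum B" and x: "x \<in> Ar X" "y \<in> Ar X" "Dom X y = Dom X x"
    "Cod X x = Dom X (bproj B)" "Cod X y = Dom X (bproj B)" "x \<cdot> bproj B = y \<cdot> bproj B"
    and s: "bsum B \<cdot> bproj B = bfst B \<cdot> bproj B"
  shows "badd X B x y \<cdot> bproj B = x \<cdot> bproj B"
proof -
  note b = fibrewise_sum_arrows[OF B]
  obtain u where u: "u \<in> Ar X" "Dom X u = Dom X x" "Cod X u = Dom X (bfst B)"
    "u \<cdot> bfst B = x" "u \<cdot> bsnd B = y" "badd X B x y = u \<cdot> bsum B"
    by (rule badd_factor[OF B x])
  show ?thesis using u b s Comp_extend[OF u(4), of "bproj B"] by simp
qed

lemma additive_morphism_badd: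
  assumes B: "fibrewise_sum B" and B': "fibrewise_sum B'" and m: "additive_morphism X B B' f g"
    and x: "x \<in> Ar X" "y \<in> Ar X" "Dom X y = Dom X x"
    "Cod X x = Dom X (bproj B)" "Cod X y = Dom X (bproj B)" "x \<cdot> bproj B = y \<cdot> bproj B"
  shows "badd X B x y \<cdot> g = badd X B' (x \<cdot> g) (y \<cdot> g)"
proof -
  note b = fibrewise_sum_arrows[OF B] and b' = fibrewise_sum_arrows[OF B']
  have g: "g \<in> Ar X" "Dom X g = Dom X (bproj B)" "Cod X g = Dom X (bproj B')"
    and f: "f \<in> Ar X" "Dom X f = Cod X (bproj B)" "Cod X f = Cod X (bproj B')"
    and gf: "g \<cdot> bproj B' = bproj B \<cdot> f"
    and s: "bsum B \<cdot> g = badd X B' (bfst B \<cdot> g) (bsnd B \<cdot> g)"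
    using m unfolding additive_morphism_def hom_def by auto
  obtain u where u: "u \<in> Ar X" "Dom X u = Dom X x" "Cod X u = Dom X (bfst B)"
    "u \<cdot> bfst B = x" "u \<cdot> bsnd B = y" "badd X B x y = u \<cdot> bsum B"
    by (rule badd_factor[OF B x])
  have "u \<cdot> badd X B' (bfst B \<cdot> g) (bsnd B \<cdot> g) = badd X B' (u \<cdot> (bfst B \<cdot> g)) (u \<cdot> (bsnd B \<cdot> g))"
    by (rule badd_precomp[OF B']) (use b b'(4) g f gf u Comp_extend[OF b(11), of f] in auto)
  then show ?thesis using u b g s by (simp add: Comp_extend[OF u(4)] Comp_extend[OF u(5)])
qed

lemma fibrewise_sum_T:
  assumes "fibrewise_sum B"
  shows "fibrewise_sum (T_bundle X B)"
  using assms fibrewise_sum_arrows[OF assms] unfolding fibrewise_sum_def T_bundle_def hom_def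
  by (auto intro: tangent_pullback_T)

lemma T_badd:
  assumes B: "fibrewise_sum B" and x: "x \<in> Ar X" "y \<in> Ar X" "Dom X y = Dom X x"
    "Cod X x = Dom X (bproj B)" "Cod X y = Dom X (bproj B)" "x \<cdot> bproj B = y \<cdot> bproj B"
  shows "tanA X (badd X B x y) = badd X (T_bundle X B) (tanA X x) (tanA X y)"
proof -
  note b = fibrewise_sum_arrows[OF B]
  obtain u where u: "u \<in> Ar X" "Dom X u = Dom X x" "Cod X u = Dom X (bfst B)"
    "u \<cdot> bfst B = x" "u \<cdot> bsnd B = y" "badd X B x y = u \<cdot> bsum B"
    by (rule badd_factor[OF B x])
  have "badd X (T_bundle X B) (tanA X x) (tanA X y) = tanA X u \<cdot> tanA X (bsum B)"
    using badd_Comp[OF fibrewise_sum_T[OF B], of "tanA X u"] u b by (auto simp: T_bundle_def)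
  then show ?thesis using u b by simp
qed

lemma additive_morphism_iff:
  "additive_morphism X B B' f g \<longleftrightarrow>
     f \<in> Ar X \<and> Dom X f = Cod X (bproj B) \<and> Cod X f = Cod X (bproj B') \<and>
     g \<in> Ar X \<and> Dom X g = Dom X (bproj B) \<and> Cod X g = Dom X (bproj B') \<and>
     bproj B \<cdot> f = g \<cdot> bproj B' \<and> bzero B \<cdot> g = f \<cdot> bzero B' \<and>
     bsum B \<cdot> g = badd X B' (bfst B \<cdot> g) (bsnd B \<cdot> g)"
  unfolding additive_morphism_def hom_def by auto

lemma additive_morphismD:
  assumes "additive_morphism X B B' f g"
  shows "f \<in> Ar X" "Dom X f = Cod X (bproj B)" "Cod X f = Cod X (bproj B')"
    "g \<in> Ar X" "Dom X g = Dom X (bproj B)" "Cod X g = Dom X (bproj B')"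
    "bproj B \<cdot> f = g \<cdot> bproj B'" "bzero B \<cdot> g = f \<cdot> bzero B'"
    "bsum B \<cdot> g = badd X B' (bfst B \<cdot> g) (bsnd B \<cdot> g)"
  using assms unfolding additive_morphism_iff by auto

lemma additive_morphism_over:
  assumes B: "fibrewise_sum B" and B': "fibrewise_sum B'" and m: "additive_morphism X B B' f g"
  shows "bfst B \<cdot> (g \<cdot> bproj B') = bsnd B \<cdot> (g \<cdot> bproj B')"
  using fibrewise_sum_arrows[OF B] additive_morphismD(1-6)[OF m]
    Comp_extend[OF fibrewise_sum_arrows(11)[OF B], of f]
  by (simp add: additive_morphismD(7)[OF m, symmetric])

lemma additive_morphism_T:
  assumes B: "fibrewise_sum B" and B': "fibrewise_sum B'" and m: "additive_morphism X B B' f g"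
    and z: "bzero B \<in> hom X (Cod X (bproj B)) (Dom X (bproj B))"
      "bzero B' \<in> hom X (Cod X (bproj B')) (Dom X (bproj B'))"
  shows "additive_morphism X (T_bundle X B) (T_bundle X B') (tanA X f) (tanA X g)"
proof -
  note b = fibrewise_sum_arrows[OF B] and b' = fibrewise_sum_arrows[OF B']
  note d = additive_morphismD[OF m] and ov = additive_morphism_over[OF B B' m]
  have z': "bzero B \<in> Ar X" "Dom X (bzero B) = Cod X (bproj B)" "Cod X (bzero B) = Dom X (bproj B)"
    "bzero B' \<in> Ar X" "Dom X (bzero B') = Cod X (bproj B')" "Cod X (bzero B') = Dom X (bproj B')"
    using z by (auto simp: hom_def)
  have "tanA X (bproj B \<cdot> f) = tanA X (g \<cdot> bproj B')" using d by simp
  moreover have "tanA X (bzero B \<cdot> g) = tanA X (f \<cdot> bzero B')" using d by simp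
  moreover have "tanA X (bsum B \<cdot> g) = badd X (T_bundle X B') (tanA X (bfst B \<cdot> g)) (tanA X (bsnd B \<cdot> g))"
    unfolding d(9) by (rule T_badd[OF B']) (use b b' d(1-7) ov in auto)
  ultimately show ?thesis
    using d(1-6) b b' z' unfolding additive_morphism_iff by (auto simp: T_bundle_def)
qed

lemma additive_morphism_Comp:
  assumes B: "fibrewise_sum B" and B': "fibrewise_sum B'" and B'': "fibrewise_sum B''"
    and m: "additive_morphism X B B' f g" and m': "additive_morphism X B' B'' f' g'"
    and z: "bzero B \<in> hom X (Cod X (bproj B)) (Dom X (bproj B))"
      "bzero B' \<in> hom X (Cod X (bproj B')) (Dom X (bproj B'))"
      "bzero B'' \<in> hom X (Cod X (bproj B'')) (Dom X (bproj B''))"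
  shows "additive_morphism X B B'' (f \<cdot> f') (g \<cdot> g')"
proof -
  note b = fibrewise_sum_arrows[OF B] and b' = fibrewise_sum_arrows[OF B'] and b'' = fibrewise_sum_arrows[OF B'']
  note d = additive_morphismD[OF m] and d' = additive_morphismD[OF m']
  note ov = additive_morphism_over[OF B B' m]
  have z': "bzero B \<in> Ar X" "Dom X (bzero B) = Cod X (bproj B)" "Cod X (bzero B) = Dom X (bproj B)"
    "bzero B' \<in> Ar X" "Dom X (bzero B') = Cod X (bproj B')" "Cod X (bzero B') = Dom X (bproj B')"
    "bzero B'' \<in> Ar X" "Dom X (bzero B'') = Cod X (bproj B'')" "Cod X (bzero B'') = Dom X (bproj B'')"
    using z by (auto simp: hom_def)
  have "bproj B \<cdot> (f \<cdot> f') = g \<cdot> (bproj B' \<cdot> f')"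
    using Comp_extend[OF d(7), of f'] b b' d(1-6) d'(1-6) by simp
  then have 1: "bproj B \<cdot> (f \<cdot> f') = (g \<cdot> g') \<cdot> bproj B''"
    using b b' b'' d(1-6) d' by simp
  have "bzero B \<cdot> (g \<cdot> g') = f \<cdot> (bzero B' \<cdot> g')"
    using Comp_extend[OF d(8), of g'] b b' d(1-6) d'(1-6) z' by simp
  then have 2: "bzero B \<cdot> (g \<cdot> g') = (f \<cdot> f') \<cdot> bzero B''"
    using b b' b'' d(1-6) d' z' by simp
  have "badd X B' (bfst B \<cdot> g) (bsnd B \<cdot> g) \<cdot> g' = badd X B'' ((bfst B \<cdot> g) \<cdot> g') ((bsnd B \<cdot> g) \<cdot> g')"
    by (rule additive_morphism_badd[OF B' B'' m']) (use b b' d(1-6) ov in auto)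
  then have 3: "bsum B \<cdot> (g \<cdot> g') = badd X B'' (bfst B \<cdot> (g \<cdot> g')) (bsnd B \<cdot> (g \<cdot> g'))"
    using Comp_extend[OF d(9), of g'] b b' d(1-6) d'(1-6) by simp
  show ?thesis unfolding additive_morphism_iff using 1 2 3 b b' b'' d(1-6) d'(1-6) by auto
qed

text \<open>The equations of an additive morphism may be checked after composing with an additive
  morphism whose two components are monic.\<close>

lemma additive_morphism_reflect:
  assumes B: "fibrewise_sum B" and B': "fibrewise_sum B'" and B'': "fibrewise_sum B''"
    and m: "additive_morphism X B B'' (f \<cdot> f') (g \<cdot> g')" and m': "additive_morphism X B' B'' f' g'"
    and f: "f \<in> hom X (Cod X (bproj B)) (Cod X (bproj B'))"
    and g: "g \<in> hom X (Dom X (bproj B)) (Dom X (bproj B'))"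
    and z: "bzero B \<in> hom X (Cod X (bproj B)) (Dom X (bproj B))"
      "bzero B' \<in> hom X (Cod X (bproj B')) (Dom X (bproj B'))"
      "bzero B'' \<in> hom X (Cod X (bproj B'')) (Dom X (bproj B''))"
    and f_mono: "\<And>u v. u \<in> Ar X \<Longrightarrow> v \<in> Ar X \<Longrightarrow> Dom X v = Dom X u \<Longrightarrow> Cod X u = Dom X f' \<Longrightarrow>
      Cod X v = Dom X f' \<Longrightarrow> u \<cdot> f' = v \<cdot> f' \<Longrightarrow> u = v"
    and g_mono: "\<And>u v. u \<in> Ar X \<Longrightarrow> v \<in> Ar X \<Longrightarrow> Dom X v = Dom X u \<Longrightarrow> Cod X u = Dom X g' \<Longrightarrow>
      Cod X v = Dom X g' \<Longrightarrow> u \<cdot> g' = v \<cdot> g' \<Longrightarrow> u = v"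
  shows "additive_morphism X B B' f g"
proof -
  note b = fibrewise_sum_arrows[OF B] and b' = fibrewise_sum_arrows[OF B'] and b'' = fibrewise_sum_arrows[OF B'']
  note d = additive_morphismD[OF m] and d' = additive_morphismD[OF m']
  have fg: "f \<in> Ar X" "Dom X f = Cod X (bproj B)" "Cod X f = Cod X (bproj B')"
    "g \<in> Ar X" "Dom X g = Dom X (bproj B)" "Cod X g = Dom X (bproj B')"
    using f g by (auto simp: hom_def)
  have z': "bzero B \<in> Ar X" "Dom X (bzero B) = Cod X (bproj B)" "Cod X (bzero B) = Dom X (bproj B)"
    "bzero B' \<in> Ar X" "Dom X (bzero B') = Cod X (bproj B')" "Cod X (bzero B') = Dom X (bproj B')"
    "bzero B'' \<in> Ar X" "Dom X (bzero B'') = Cod X (bproj B'')" "Cod X (bzero B'') = Dom X (bproj B'')"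
    using z by (auto simp: hom_def)
  have 1: "bproj B \<cdot> f = g \<cdot> bproj B'"
    by (rule f_mono) (use b b' b'' fg d d' in auto)
  have 2: "bzero B \<cdot> g = f \<cdot> bzero B'"
    by (rule g_mono) (use b b' b'' fg d d' z' in auto)
  have ov: "bfst B \<cdot> (g \<cdot> bproj B') = bsnd B \<cdot> (g \<cdot> bproj B')"
    using Comp_extend[OF b(11), of f] 1 b fg by simp
  have s: "badd X B' (bfst B \<cdot> g) (bsnd B \<cdot> g) \<cdot> g' = badd X B'' ((bfst B \<cdot> g) \<cdot> g') ((bsnd B \<cdot> g) \<cdot> g')"
    by (rule additive_morphism_badd[OF B' B'' m']) (use b b' fg ov in auto)
  have 4: "badd X B' (bfst B \<cdot> g) (bsnd B \<cdot> g) \<in> Ar X"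
     "Dom X (badd X B' (bfst B \<cdot> g) (bsnd B \<cdot> g)) = Dom X (bfst B \<cdot> g)"
     "Cod X (badd X B' (bfst B \<cdot> g) (bsnd B \<cdot> g)) = Dom X (bproj B')"
    using badd_arrow[OF B', of "bfst B \<cdot> g" "bsnd B \<cdot> g"] b b' fg ov by auto
  have 3: "bsum B \<cdot> g = badd X B' (bfst B \<cdot> g) (bsnd B \<cdot> g)"
    by (rule g_mono) (use b b' b'' fg d d'(4,5,6) s 4 in auto)
  show ?thesis unfolding additive_morphism_iff using 1 2 3 fg by auto
qed

text \<open>Each monoid law for \<open>B\<close> holds after composing with the monomorphism \<open>g\<close>, where it is the law for
  \<open>B'\<close>.\<close>

lemma additive_bundle_reflect:
  assumes B: "fibrewise_sum B" and B': "fibrewise_sum B'"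
    and m: "additive_morphism X B B' (Id X (Cod X (bproj B))) g" and add: "additive_bundle X B'"
    and z: "bzero B \<in> hom X (Cod X (bproj B)) (Dom X (bproj B))"
    and mono: "\<And>u v. u \<in> Ar X \<Longrightarrow> v \<in> Ar X \<Longrightarrow> Dom X v = Dom X u \<Longrightarrow> Cod X u = Dom X g \<Longrightarrow>
      Cod X v = Dom X g \<Longrightarrow> u \<cdot> g = v \<cdot> g \<Longrightarrow> u = v"
  shows "additive_bundle X B"
proof -
  note b = fibrewise_sum_arrows[OF B] and b' = fibrewise_sum_arrows[OF B']
  note d = additive_morphismD[OF m]
  have base: "Cod X (bproj B') = Cod X (bproj B)" using d b by simp
  have pg: "g \<cdot> bproj B' = bproj B" using d b by simp
  have z1: "bzero B \<in> Ar X" "Dom X (bzero B) = Cod X (bproj B)" "Cod X (bzero B) = Dom X (bproj B)"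
    using z by (auto simp: hom_def)
  have z2: "bzero B' \<in> Ar X" "Dom X (bzero B') = Cod X (bproj B)" "Cod X (bzero B') = Dom X (bproj B')"
      "bzero B' \<cdot> bproj B' = Id X (Cod X (bproj B'))"
    and s': "bsum B' \<cdot> bproj B' = bfst B' \<cdot> bproj B'"
    and unit: "\<And>N x. x \<in> hom X N (Dom X (bproj B')) \<Longrightarrow> badd X B' x (x \<cdot> bproj B' \<cdot> bzero B') = x"
    and comm: "\<And>N x y. x \<in> hom X N (Dom X (bproj B')) \<Longrightarrow> y \<in> hom X N (Dom X (bproj B')) \<Longrightarrow>
      x \<cdot> bproj B' = y \<cdot> bproj B' \<Longrightarrow> badd X B' x y = badd X B' y x"
    and assoc: "\<And>N x y w. x \<in> hom X N (Dom X (bproj B')) \<Longrightarrow> y \<in> hom X N (Dom X (bproj B')) \<Longrightarrow>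
      w \<in> hom X N (Dom X (bproj B')) \<Longrightarrow> x \<cdot> bproj B' = y \<cdot> bproj B' \<Longrightarrow> y \<cdot> bproj B' = w \<cdot> bproj B' \<Longrightarrow>
      badd X B' (badd X B' x y) w = badd X B' x (badd X B' y w)"
    using add base unfolding additive_bundle_def Let_def by (auto simp: in_hom_iff)
  have zg: "bzero B \<cdot> g = bzero B'" using d z2 b by simp
  have ov: "x \<cdot> (g \<cdot> bproj B') = x \<cdot> bproj B" for x using pg by simp
  have badd_g: "badd X B x y \<cdot> g = badd X B' (x \<cdot> g) (y \<cdot> g)"
    if "x \<in> Ar X" "y \<in> Ar X" "Dom X y = Dom X x"
    "Cod X x = Dom X (bproj B)" "Cod X y = Dom X (bproj B)" "x \<cdot> bproj B = y \<cdot> bproj B" for x y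
    by (rule additive_morphism_badd[OF B B' m that])
  have zp: "bzero B \<cdot> bproj B = Id X (Cod X (bproj B))"
    using Comp_extend[OF zg, of "bproj B'"] z1 z2 d b b' pg base by simp
  have over: "bfst B \<cdot> (g \<cdot> bproj B') = bsnd B \<cdot> (g \<cdot> bproj B')" using pg b by simp
  have "badd X B' (bfst B \<cdot> g) (bsnd B \<cdot> g) \<cdot> bproj B' = (bfst B \<cdot> g) \<cdot> bproj B'"
    by (rule badd_proj[OF B']) (use b b' d(4-6) over s' in auto)
  then have sp: "bsum B \<cdot> bproj B = bfst B \<cdot> bproj B"
    using Comp_extend[OF d(9), of "bproj B'"] b b' d(4-6) pg by simp
  note ba = badd_arrow[OF B]
  note bp = badd_proj[OF B _ _ _ _ _ _ sp]
  show ?thesis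
    unfolding additive_bundle_def Let_def
  proof (intro conjI allI ballI impI b(1) zp sp z)
    show "bsum B \<in> hom X (Dom X (bfst B)) (Dom X (bproj B))" using b by (simp add: hom_def)
  next
    fix N x assume "x \<in> hom X N (Dom X (bproj B))"
    then have x: "x \<in> Ar X" "Dom X x = N" "Cod X x = Dom X (bproj B)" by (auto simp: hom_def)
    have 1: "badd X B x (x \<cdot> bproj B \<cdot> bzero B) \<cdot> g = badd X B' (x \<cdot> g) ((x \<cdot> bproj B \<cdot> bzero B) \<cdot> g)"
      by (rule badd_g) (use x b z1 zp in auto)
    have 2: "(x \<cdot> bproj B \<cdot> bzero B) \<cdot> g = (x \<cdot> g) \<cdot> bproj B' \<cdot> bzero B'"
      using x b b' z1 z2 d(4-6) zg Comp_extend[OF pg, of "bzero B'"] by (simp add: base)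
    show "badd X B x (x \<cdot> bproj B \<cdot> bzero B) = x"
    proof (rule mono)
      show "badd X B x (x \<cdot> bproj B \<cdot> bzero B) \<cdot> g = x \<cdot> g"
        unfolding 1 2 by (rule unit) (use x d(4-6) in \<open>auto simp: hom_def\<close>)
    qed (use ba[of x "x \<cdot> bproj B \<cdot> bzero B"] x b z1 zp d(4-6) 1 2 in auto)
  next
    fix N x y assume "x \<in> hom X N (Dom X (bproj B))" "y \<in> hom X N (Dom X (bproj B))"
      and xy: "x \<cdot> bproj B = y \<cdot> bproj B"
    then have x: "x \<in> Ar X" "Dom X x = N" "Cod X x = Dom X (bproj B)" "y \<in> Ar X" "Dom X y = N" "Cod X y = Dom X (bproj B)"
      by (auto simp: hom_def)
    have 1: "badd X B' (x \<cdot> g) (y \<cdot> g) = badd X B' (y \<cdot> g) (x \<cdot> g)"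
      by (rule comm) (use x d(4-6) b' ov xy in \<open>auto simp: hom_def\<close>)
    show "badd X B x y = badd X B y x"
      by (rule mono) (use x d(4-6) xy ba[of x y] ba[of y x] badd_g[of x y] badd_g[of y x] 1 in auto)
  next
    fix N x y w assume "x \<in> hom X N (Dom X (bproj B))" "y \<in> hom X N (Dom X (bproj B))"
        "w \<in> hom X N (Dom X (bproj B))"
      and "x \<cdot> bproj B = y \<cdot> bproj B \<and> y \<cdot> bproj B = w \<cdot> bproj B"
    then have x: "x \<in> Ar X" "Dom X x = N" "Cod X x = Dom X (bproj B)" "y \<in> Ar X" "Dom X y = N"
      "Cod X y = Dom X (bproj B)" "w \<in> Ar X" "Dom X w = N" "Cod X w = Dom X (bproj B)"
      and xy: "x \<cdot> bproj B = y \<cdot> bproj B" "y \<cdot> bproj B = w \<cdot> bproj B"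
      by (auto simp: hom_def)
    have 1: "badd X B' (badd X B' (x \<cdot> g) (y \<cdot> g)) (w \<cdot> g) = badd X B' (x \<cdot> g) (badd X B' (y \<cdot> g) (w \<cdot> g))"
      by (rule assoc) (use x d(4-6) b' ov xy in \<open>auto simp: hom_def\<close>)
    note a = ba[of x y] ba[of y w] ba[of "badd X B x y" w] ba[of x "badd X B y w"]
      bp[of x y] bp[of y w]
    have 2: "badd X B (badd X B x y) w \<cdot> g = badd X B' (badd X B x y \<cdot> g) (w \<cdot> g)"
      by (rule badd_g) (use x xy a(1-3) bp[of x y] in auto)
    have 3: "badd X B x (badd X B y w) \<cdot> g = badd X B' (x \<cdot> g) (badd X B y w \<cdot> g)"
      by (rule badd_g) (use x xy a(4-6) bp[of y w] in auto)
    show "badd X B (badd X B x y) w = badd X B x (badd X B y w)"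
      by (rule mono) (use x d(4-6) xy a 1 2 3 badd_g[of x y] badd_g[of y w] in auto)
  qed
qed

end
section \<open>The tangent bundle and the universal lift\<close>

context tangent_category
begin

lemma tanA_pow_eq:
  assumes "a \<cdot> b = c \<cdot> d" "a \<in> Ar X" "b \<in> Ar X" "Cod X a = Dom X b"
    "c \<in> Ar X" "d \<in> Ar X" "Cod X c = Dom X d"
  shows "(tanA X ^^ m) a \<cdot> (tanA X ^^ m) b = (tanA X ^^ m) c \<cdot> (tanA X ^^ m) d"
  using assms by (metis tanA_pow_Comp)

lemma tangent_bundle_simps [simp]:
  "bproj (tangent_bundle X M) = tproj X M" "bzero (tangent_bundle X M) = tzero X M"
  "bfst (tangent_bundle X M) = tfst X M" "bsnd (tangent_bundle X M) = tsnd X M"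
  "bsum (tangent_bundle X M) = tsum X M" "blift (tangent_bundle X M) = tlift X M"
  by (simp_all add: tangent_bundle_def)

lemma T_bundle_simps [simp]:
  "bproj (T_bundle X B) = tanA X (bproj B)" "bzero (T_bundle X B) = tanA X (bzero B)"
  "bfst (T_bundle X B) = tanA X (bfst B)" "bsnd (T_bundle X B) = tanA X (bsnd B)"
  "bsum (T_bundle X B) = tanA X (bsum B)" "blift (T_bundle X B) = tanA X (blift B)"
  by (simp_all add: T_bundle_def)

lemma structure_arrows [simp]:
  assumes "M \<in> Ob X"
  shows "tproj X M \<in> Ar X" "Dom X (tproj X M) = tanO X M" "Cod X (tproj X M) = M"
    "tzero X M \<in> Ar X" "Dom X (tzero X M) = M" "Cod X (tzero X M) = tanO X M"
    "tlift X M \<in> Ar X" "Dom X (tlift X M) = tanO X M" "Cod X (tlift X M) = tanO X (tanO X M)"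
    "tflip X M \<in> Ar X" "Dom X (tflip X M) = tanO X (tanO X M)"
    "Cod X (tflip X M) = tanO X (tanO X M)"
  using tproj_in_hom tzero_in_hom tlift_in_hom tflip_in_hom assms by (auto simp: hom_def)

lemma fibrewise_sum_tangent: "M \<in> Ob X \<Longrightarrow> fibrewise_sum (tangent_bundle X M)"
  unfolding fibrewise_sum_def using T2_tangent_pullback tsum_in_hom by simp

lemma sum_arrows [simp]:
  assumes "M \<in> Ob X"
  shows "tfst X M \<in> Ar X" "Cod X (tfst X M) = tanO X M"
    "tsnd X M \<in> Ar X" "Dom X (tsnd X M) = Dom X (tfst X M)" "Cod X (tsnd X M) = tanO X M"
    "tsum X M \<in> Ar X" "Dom X (tsum X M) = Dom X (tfst X M)" "Cod X (tsum X M) = tanO X M"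
  using fibrewise_sum_arrows[OF fibrewise_sum_tangent[OF assms]] assms by simp_all

lemma tzero_tproj:
  assumes "M \<in> Ob X" shows "tzero X M \<cdot> tproj X M = Id X M"
  using tangent_additive[OF assms] assms unfolding additive_bundle_def Let_def by simp

lemma tzero_in_hom_bundle:
  "M \<in> Ob X \<Longrightarrow> bzero (tangent_bundle X M) \<in> hom X (Cod X (bproj (tangent_bundle X M))) (Dom X (bproj (tangent_bundle X M)))"
  by (simp add: hom_def)

lemma T_zero_in_hom:
  assumes "bzero B \<in> hom X (Cod X (bproj B)) (Dom X (bproj B))" "bproj B \<in> Ar X"
  shows "bzero (T_bundle X B) \<in> hom X (Cod X (bproj (T_bundle X B))) (Dom X (bproj (T_bundle X B)))"
  using assms by (auto simp: hom_def)

lemma tangent_map_additive: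
  assumes "f \<in> Ar X" "Dom X f = M" "Cod X f = N"
  shows "additive_morphism X (tangent_bundle X M) (tangent_bundle X N) f (tanA X f)"
  using assms tproj_natural[of f M N] tzero_natural[of f M N] tsum_natural[of f M N] arrow_Ob[of f]
  unfolding additive_morphism_iff badd_def by (auto simp: hom_def)

text \<open>Since \<open>l c = l\<close>, the flip transports the additivity of the lift from \<open>Tp\<close> to \<open>p\<^sub>T\<close>.\<close>

lemma tlift_additive_tproj:
  assumes M: "M \<in> Ob X"
  shows "additive_morphism X (tangent_bundle X M) (tangent_bundle X (tanO X M)) (tzero X M) (tlift X M)"
proof -
  note t = fibrewise_sum_tangent[OF M] and z = tzero_in_hom_bundle[OF M]
  have "additive_morphism X (tangent_bundle X M) (tangent_bundle X (tanO X M))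
      (tzero X M \<cdot> Id X (tanO X M)) (tlift X M \<cdot> tflip X M)"
    by (rule additive_morphism_Comp[OF t fibrewise_sum_T[OF t] fibrewise_sum_tangent
          tlift_additive[OF M] tflip_additive[OF M] z T_zero_in_hom[OF z] tzero_in_hom_bundle])
      (use M in auto)
  then show ?thesis using M tlift_tflip[OF M] by simp
qed

lemma tangent_bundle_differential:
  assumes M: "M \<in> Ob X" and d: "tangent_display X (tproj X M)"
  shows "differential_bundle X (tangent_bundle X M)"
  unfolding differential_bundle_def Let_def
  using d Tn_exist[OF M] T2_tangent_pullback[OF M] tangent_additive[OF M] tlift_additive[OF M]
    tlift_additive_tproj[OF M] tlift_tlift[OF M] tlift_universal[OF M] M
  by simp

lemma lift_arrow:
  assumes "additive_morphism X B (T_bundle X B) f (blift B)" "bproj B \<in> Ar X"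
  shows "blift B \<in> Ar X" "Dom X (blift B) = Dom X (bproj B)" "Cod X (blift B) = tanO X (Dom X (bproj B))"
    "blift B \<cdot> tanA X (bproj B) = bproj B \<cdot> f"
  using additive_morphismD[OF assms(1)] assms(2) by auto

text \<open>The two summands of \<open>\<xi>\<close> lie over the same element: both project to \<open>\<pi> q z\<^sub>M\<close>, the first
  because the lift covers the zero section, the second by naturality of zero.\<close>

lemma xi_summands:
  assumes B: "fibrewise_sum B"
    and l: "additive_morphism X B (T_bundle X B) (tzero X (Cod X (bproj B))) (blift B)"
  shows "bfst B \<cdot> blift B \<in> Ar X" "bsnd B \<cdot> tzero X (Dom X (bproj B)) \<in> Ar X"
    "Dom X (bsnd B \<cdot> tzero X (Dom X (bproj B))) = Dom X (bfst B \<cdot> blift B)"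
    "Cod X (bfst B \<cdot> blift B) = Dom X (bproj (T_bundle X B))"
    "Cod X (bsnd B \<cdot> tzero X (Dom X (bproj B))) = Dom X (bproj (T_bundle X B))"
    "(bfst B \<cdot> blift B) \<cdot> bproj (T_bundle X B) = (bsnd B \<cdot> tzero X (Dom X (bproj B))) \<cdot> bproj (T_bundle X B)"
proof -
  note b = fibrewise_sum_arrows[OF B] note a = lift_arrow[OF l b(4)]
  have z: "tzero X (Dom X (bproj B)) \<cdot> tanA X (bproj B) = bproj B \<cdot> tzero X (Cod X (bproj B))"
    using tzero_natural[of "bproj B" "Dom X (bproj B)" "Cod X (bproj B)"] b by (simp add: hom_def)
  show "bfst B \<cdot> blift B \<in> Ar X" "bsnd B \<cdot> tzero X (Dom X (bproj B)) \<in> Ar X"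
    "Dom X (bsnd B \<cdot> tzero X (Dom X (bproj B))) = Dom X (bfst B \<cdot> blift B)"
    "Cod X (bfst B \<cdot> blift B) = Dom X (bproj (T_bundle X B))"
    "Cod X (bsnd B \<cdot> tzero X (Dom X (bproj B))) = Dom X (bproj (T_bundle X B))"
    using b a by auto
  show "(bfst B \<cdot> blift B) \<cdot> bproj (T_bundle X B) = (bsnd B \<cdot> tzero X (Dom X (bproj B))) \<cdot> bproj (T_bundle X B)"
    using b a z Comp_extend[OF b(11), of "tzero X (Cod X (bproj B))"] by simp
qed

lemma xi_arrow:
  assumes B: "fibrewise_sum B"
    and l: "additive_morphism X B (T_bundle X B) (tzero X (Cod X (bproj B))) (blift B)"
  shows "xi X B \<in> Ar X" "Dom X (xi X B) = Dom X (bfst B)" "Cod X (xi X B) = tanO X (Dom X (bproj B))"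
  using badd_arrow[OF fibrewise_sum_T[OF B] xi_summands[OF B l]] fibrewise_sum_arrows[OF B]
    lift_arrow[OF l]
  unfolding xi_def by auto

text \<open>Here \<open>j\<close> is \<open>g \<times> g\<close>; linearity handles the first summand of \<open>\<xi>\<close>, naturality of zero
  the second.\<close>

lemma xi_natural:
  assumes B: "fibrewise_sum B" and B': "fibrewise_sum B'"
    and l: "additive_morphism X B (T_bundle X B) (tzero X (Cod X (bproj B))) (blift B)"
    and l': "additive_morphism X B' (T_bundle X B') (tzero X (Cod X (bproj B'))) (blift B')"
    and z: "bzero B \<in> hom X (Cod X (bproj B)) (Dom X (bproj B))"
      "bzero B' \<in> hom X (Cod X (bproj B')) (Dom X (bproj B'))"
    and m: "additive_morphism X B B' f g" and lin: "g \<cdot> blift B' = blift B \<cdot> tanA X g"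
    and j: "j \<in> Ar X" "Cod X j = Dom X (bfst B')" "j \<cdot> bfst B' = bfst B \<cdot> g" "j \<cdot> bsnd B' = bsnd B \<cdot> g"
  shows "xi X B \<cdot> tanA X g = j \<cdot> xi X B'"
proof -
  note b = fibrewise_sum_arrows[OF B] and b' = fibrewise_sum_arrows[OF B']
  note a = lift_arrow[OF l b(4)] and a' = lift_arrow[OF l' b'(4)] and d = additive_morphismD(1-6)[OF m]
  have zg: "g \<cdot> tzero X (Dom X (bproj B')) = tzero X (Dom X (bproj B)) \<cdot> tanA X g"
    using tzero_natural[of g "Dom X (bproj B)" "Dom X (bproj B')"] d by (simp add: hom_def)
  have "Dom X j = Dom X (j \<cdot> bfst B')" using j(1,2) b' by simp
  then have dj: "Dom X j = Dom X (bfst B)" using b d by (simp add: j)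
  have "xi X B \<cdot> tanA X g = badd X (T_bundle X B') ((bfst B \<cdot> blift B) \<cdot> tanA X g)
      ((bsnd B \<cdot> tzero X (Dom X (bproj B))) \<cdot> tanA X g)"
    unfolding xi_def
    by (rule additive_morphism_badd[OF fibrewise_sum_T[OF B] fibrewise_sum_T[OF B']
          additive_morphism_T[OF B B' m z] xi_summands[OF B l]])
  also have "(bfst B \<cdot> blift B) \<cdot> tanA X g = j \<cdot> (bfst B' \<cdot> blift B')"
    using b b' a(1-3) a'(1-3) d j(1,2) by (simp add: lin[symmetric] Comp_extend[OF j(3)])
  also have "(bsnd B \<cdot> tzero X (Dom X (bproj B))) \<cdot> tanA X g = j \<cdot> (bsnd B' \<cdot> tzero X (Dom X (bproj B')))"
    using b b' d j(1,2) by (simp add: zg[symmetric] Comp_extend[OF j(4)])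
  also have "badd X (T_bundle X B') (j \<cdot> (bfst B' \<cdot> blift B')) (j \<cdot> (bsnd B' \<cdot> tzero X (Dom X (bproj B'))))
      = j \<cdot> xi X B'"
    unfolding xi_def
    by (rule badd_precomp[OF fibrewise_sum_T[OF B'] xi_summands[OF B' l'], symmetric])
      (use b' a'(1-3) j(1,2) in auto)
  finally show ?thesis .
qed

text \<open>On a pair of zero vectors both summands of \<open>\<xi>\<close> equal \<open>z\<close> followed by \<open>Tz\<close>, and this is
  zero for the addition of \<open>Tp\<close>, as the image under \<open>T\<close> of \<open>z + z = z\<close>.\<close>

lemma zero_xi:
  assumes M: "M \<in> Ob X" and W: "W \<in> Ar X" "Dom X W = M" "Cod X W = Dom X (tfst X M)"
    "W \<cdot> tfst X M = tzero X M" "W \<cdot> tsnd X M = tzero X M"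
  shows "W \<cdot> xi X (tangent_bundle X M) = tzero X M \<cdot> tanA X (tzero X M)"
proof -
  let ?B = "tangent_bundle X M"
  note t = fibrewise_sum_tangent[OF M]
  have l: "additive_morphism X ?B (T_bundle X ?B) (tzero X (Cod X (bproj ?B))) (blift ?B)"
    using tlift_additive[OF M] M by simp
  have zl: "tzero X M \<cdot> tlift X M = tzero X M \<cdot> tanA X (tzero X M)"
    using additive_morphismD(8)[OF tlift_additive[OF M]] by simp
  have zz: "tzero X M \<cdot> tzero X (tanO X M) = tzero X M \<cdot> tanA X (tzero X M)"
    using tzero_natural[of "tzero X M" M "tanO X M"] M by (simp add: hom_def)
  have s: "badd X ?B (tzero X M) (tzero X M) = tzero X M"
  proof -
    have "\<forall>N. \<forall>x \<in> hom X N (tanO X M). badd X ?B x (x \<cdot> tproj X M \<cdot> tzero X M) = x"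
      using tangent_additive[OF M] M unfolding additive_bundle_def Let_def by simp
    then have "badd X ?B (tzero X M) (tzero X M \<cdot> tproj X M \<cdot> tzero X M) = tzero X M"
      using M by (simp add: in_hom_iff)
    then show ?thesis using M by (simp add: tzero_tproj)
  qed
  have "W \<cdot> xi X ?B = badd X (T_bundle X ?B) (W \<cdot> (bfst ?B \<cdot> blift ?B)) (W \<cdot> (bsnd ?B \<cdot> tzero X (Dom X (bproj ?B))))"
    unfolding xi_def
    by (rule badd_precomp[OF fibrewise_sum_T[OF t] xi_summands[OF t l]]) (use M W in auto)
  also have "W \<cdot> (bfst ?B \<cdot> blift ?B) = tzero X M \<cdot> tanA X (tzero X M)"
    using M W(1-3) by (simp add: Comp_extend[OF W(4)] zl)
  also have "W \<cdot> (bsnd ?B \<cdot> tzero X (Dom X (bproj ?B))) = tzero X M \<cdot> tanA X (tzero X M)"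
    using M W(1-3) by (simp add: Comp_extend[OF W(5)] zz)
  also have "badd X (T_bundle X ?B) (tzero X M \<cdot> tanA X (tzero X M)) (tzero X M \<cdot> tanA X (tzero X M))
      = tzero X M \<cdot> badd X (T_bundle X ?B) (tanA X (tzero X M)) (tanA X (tzero X M))"
    by (rule badd_precomp[OF fibrewise_sum_T[OF t], symmetric]) (use M in auto)
  also have "badd X (T_bundle X ?B) (tanA X (tzero X M)) (tanA X (tzero X M))
      = tanA X (badd X ?B (tzero X M) (tzero X M))"
    by (rule T_badd[OF t, symmetric]) (use M in auto)
  finally show ?thesis by (simp add: s)
qed

end

section \<open>The vertical bundle\<close>

locale vertical = tangent_category X
  for X :: "('o, 'a, 'm) tangent_data_scheme" (structure) +
  fixes q \<iota> \<tau> :: 'a and V :: "'a bundle_data"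
  assumes q_arrow [simp]: "q \<in> Ar X"
    and vertical_bundle: "vertical_bundle X q V \<iota> \<tau>"
begin

abbreviation "E \<equiv> Dom X q"
abbreviation "M \<equiv> Cod X q"

lemma vertical_pullback: "tangent_pullback X \<iota> \<tau> (tanA X q) (tzero X M)"
  using vertical_bundle unfolding vertical_bundle_def Let_def by simp

lemma iota_arrow [simp]:
  "\<iota> \<in> Ar X" "Cod X \<iota> = tanO X E" "\<tau> \<in> Ar X" "Dom X \<tau> = Dom X \<iota>" "Cod X \<tau> = M"
  using pullback_arrows[OF tangent_pullbackD[OF vertical_pullback]] by auto

lemma iota_square: "\<iota> \<cdot> tanA X q = \<tau> \<cdot> tzero X M"
  using pullback_arrows[OF tangent_pullbackD[OF vertical_pullback]] by auto

lemma bproj_V [simp]: "bproj V = \<iota> \<cdot> tproj X E"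
  using vertical_bundle unfolding vertical_bundle_def Let_def by simp

lemma fibrewise_sum_V: "fibrewise_sum V"
  using vertical_bundle unfolding vertical_bundle_def Let_def fibrewise_sum_def by simp

lemma V_arrows [simp]:
  "bfst V \<in> Ar X" "Cod X (bfst V) = Dom X \<iota>" "bsnd V \<in> Ar X" "Dom X (bsnd V) = Dom X (bfst V)"
  "Cod X (bsnd V) = Dom X \<iota>" "bsum V \<in> Ar X" "Dom X (bsum V) = Dom X (bfst V)"
  "Cod X (bsum V) = Dom X \<iota>" "bzero V \<in> Ar X" "Dom X (bzero V) = E" "Cod X (bzero V) = Dom X \<iota>"
  "blift V \<in> Ar X" "Dom X (blift V) = Dom X \<iota>" "Cod X (blift V) = tanO X (Dom X \<iota>)"
  using fibrewise_sum_arrows[OF fibrewise_sum_V] vertical_bundle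
  unfolding vertical_bundle_def Let_def by (auto simp: hom_def)

lemma V_equations:
  "bzero V \<cdot> \<iota> = tzero X E" "blift V \<cdot> tanA X \<iota> = \<iota> \<cdot> tlift X E"
  "bsum V \<cdot> \<iota> = badd X (tangent_bundle X E) (bfst V \<cdot> \<iota>) (bsnd V \<cdot> \<iota>)"
  using vertical_bundle unfolding vertical_bundle_def Let_def by auto

text \<open>\<open>z\<^sub>M p\<^sub>M = id\<close> recovers \<open>\<tau>\<close> from the defining square of \<open>V\<close>.\<close>

lemma tau_eq: "\<tau> = \<iota> \<cdot> (tproj X E \<cdot> q)"
proof -
  have "\<iota> \<cdot> (tanA X q \<cdot> tproj X M) = \<tau>"
    using Comp_extend[OF iota_square, of "tproj X M"] tzero_tproj[of M] by simp
  then show ?thesis using tproj_natural[of q E M] by (simp add: hom_def)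
qed

lemma iota_mono:
  assumes "u \<in> Ar X" "v \<in> Ar X" "Dom X v = Dom X u" "Cod X u = Dom X \<iota>" "Cod X v = Dom X \<iota>"
    "u \<cdot> \<iota> = v \<cdot> \<iota>"
  shows "u = v"
  by (rule pullback_split_mono[OF tangent_pullbackD[OF vertical_pullback], of "tproj X M"])
    (use assms in \<open>auto simp: tzero_tproj\<close>)

lemma T_zero_split: "tanA X (tzero X M) \<cdot> tanA X (tproj X M) = Id X (tanO X M)"
  using tanA_Comp'[of "tzero X M" "tproj X M"] by (simp add: tzero_tproj)

lemma T_iota_mono:
  assumes "u \<in> Ar X" "v \<in> Ar X" "Dom X v = Dom X u" "Cod X u = tanO X (Dom X \<iota>)"
    "Cod X v = tanO X (Dom X \<iota>)" "u \<cdot> tanA X \<iota> = v \<cdot> tanA X \<iota>"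
  shows "u = v"
  by (rule pullback_split_mono[OF tangent_pullbackD[OF tangent_pullback_T[OF vertical_pullback]],
        of "tanA X (tproj X M)"])
    (use assms in \<open>auto simp: T_zero_split\<close>)

lemma TT_iota_mono:
  assumes "u \<in> Ar X" "v \<in> Ar X" "Dom X v = Dom X u" "Cod X u = tanO X (tanO X (Dom X \<iota>))"
    "Cod X v = tanO X (tanO X (Dom X \<iota>))" "u \<cdot> tanA X (tanA X \<iota>) = v \<cdot> tanA X (tanA X \<iota>)"
  shows "u = v"
  by (rule pullback_split_mono[OF tangent_pullbackD[OF tangent_pullback_T[OF tangent_pullback_T[OF vertical_pullback]]],
        of "tanA X (tanA X (tproj X M))"])
    (use assms tanA_Comp'[of "tanA X (tzero X M)" "tanA X (tproj X M)"] in \<open>auto simp: T_zero_split\<close>)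

lemma V_zero_in_hom: "bzero V \<in> hom X (Cod X (bproj V)) (Dom X (bproj V))"
  by (simp add: hom_def)

lemma iota_additive: "additive_morphism X V (tangent_bundle X E) (Id X (Cod X (bproj V))) \<iota>"
  unfolding additive_morphism_iff by (simp add: V_equations)

lemma V_additive: "additive_bundle X V"
  by (rule additive_bundle_reflect[OF fibrewise_sum_V fibrewise_sum_tangent iota_additive
        tangent_additive V_zero_in_hom iota_mono]) auto

text \<open>Followed by \<open>T\<iota>\<close>, the vertical lift becomes \<open>\<iota>\<close> followed by the tangent lift, which is
  additive as a composite; \<open>T\<iota>\<close> is additive and monic.\<close>

lemma V_lift_additive_T: "additive_morphism X V (T_bundle X V) (tzero X E) (blift V)"
proof -
  let ?P = "tangent_bundle X E"
  have P: "fibrewise_sum ?P" and z: "bzero ?P \<in> hom X (Cod X (bproj ?P)) (Dom X (bproj ?P))"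
    by (simp_all add: fibrewise_sum_tangent hom_def)
  have "additive_morphism X V (T_bundle X ?P) (Id X (Cod X (bproj V)) \<cdot> tzero X E) (\<iota> \<cdot> tlift X E)"
    by (rule additive_morphism_Comp[OF fibrewise_sum_V P fibrewise_sum_T[OF P] iota_additive
          tlift_additive V_zero_in_hom z T_zero_in_hom[OF z]]) auto
  then have m: "additive_morphism X V (T_bundle X ?P) (tzero X E \<cdot> tanA X (Id X (Cod X (bproj V)))) (blift V \<cdot> tanA X \<iota>)"
    by (simp add: V_equations)
  show ?thesis
    by (rule additive_morphism_reflect[OF fibrewise_sum_V fibrewise_sum_T[OF fibrewise_sum_V]
          fibrewise_sum_T[OF P] m additive_morphism_T[OF fibrewise_sum_V P iota_additive V_zero_in_hom z]
          _ _ V_zero_in_hom T_zero_in_hom[OF V_zero_in_hom] T_zero_in_hom[OF z]])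
      (auto simp: hom_def intro: T_iota_mono)
qed

text \<open>As before, but now \<open>(\<iota>, T\<iota>)\<close> is additive by naturality of the tangent addition.\<close>

lemma V_lift_additive: "additive_morphism X V (tangent_bundle X (Dom X (bproj V))) (bzero V) (blift V)"
proof -
  let ?P = "tangent_bundle X E" and ?Q = "tangent_bundle X (Dom X \<iota>)" and ?R = "tangent_bundle X (tanO X E)"
  have S: "fibrewise_sum ?P" "fibrewise_sum ?Q" "fibrewise_sum ?R"
    and z: "bzero ?P \<in> hom X (Cod X (bproj ?P)) (Dom X (bproj ?P))"
      "bzero ?Q \<in> hom X (Cod X (bproj ?Q)) (Dom X (bproj ?Q))"
      "bzero ?R \<in> hom X (Cod X (bproj ?R)) (Dom X (bproj ?R))"
    by (simp_all add: fibrewise_sum_tangent hom_def)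
  have "additive_morphism X V ?R (Id X (Cod X (bproj V)) \<cdot> tzero X E) (\<iota> \<cdot> tlift X E)"
    by (rule additive_morphism_Comp[OF fibrewise_sum_V S(1) S(3) iota_additive
          tlift_additive_tproj V_zero_in_hom z(1,3)]) auto
  then have m: "additive_morphism X V ?R (bzero V \<cdot> \<iota>) (blift V \<cdot> tanA X \<iota>)"
    by (simp add: V_equations)
  have "additive_morphism X V ?Q (bzero V) (blift V)"
    by (rule additive_morphism_reflect[OF fibrewise_sum_V S(2,3) m tangent_map_additive
          _ _ V_zero_in_hom z(2,3)])
      (auto simp: hom_def intro: iota_mono T_iota_mono)
  then show ?thesis by simp
qed

lemma V_lift_lift: "blift V \<cdot> tlift X (Dom X (bproj V)) = blift V \<cdot> tanA X (blift V)"
proof (rule TT_iota_mono)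
  have n: "tlift X (Dom X \<iota>) \<cdot> tanA X (tanA X \<iota>) = tanA X \<iota> \<cdot> tlift X (tanO X E)"
    using tlift_natural[of \<iota> "Dom X \<iota>" "tanO X E"] by (simp add: hom_def)
  have t: "tanA X (blift V) \<cdot> tanA X (tanA X \<iota>) = tanA X \<iota> \<cdot> tanA X (tlift X E)"
    using tanA_Comp'[of "blift V" "tanA X \<iota>"] by (simp add: V_equations)
  show "(blift V \<cdot> tlift X (Dom X (bproj V))) \<cdot> tanA X (tanA X \<iota>) = (blift V \<cdot> tanA X (blift V)) \<cdot> tanA X (tanA X \<iota>)"
    by (simp add: n t Comp_extend[OF V_equations(2)] tlift_tlift)
qed auto

text \<open>In terms of elements: a vector on \<open>V\<close> lying over a zero vector of \<open>E\<close> is \<open>\<xi>\<^sub>E\<close> of a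
  pair of tangent vectors on \<open>E\<close>; its image on \<open>M\<close> is tangent to the zero section, so universality
  on \<open>M\<close> forces both vectors of the pair to be vertical.\<close>

lemma V_universal: "universal_lift X V"
proof -
  let ?P = "tangent_bundle X E" and ?N = "tangent_bundle X M"
  let ?\<Delta> = "pairing X (tfst X M) (tsnd X M) (tzero X M) (tzero X M)"
  let ?j = "pairing X (tfst X E) (tsnd X E) (bfst V \<cdot> \<iota>) (bsnd V \<cdot> \<iota>)"
  let ?F = "pairing X (tfst X M) (tsnd X M) (tfst X E \<cdot> tanA X q) (tsnd X E \<cdot> tanA X q)"
  have E2: "is_pullback X (tfst X E) (tsnd X E) (tproj X E) (tproj X E)"
    and M2: "is_pullback X (tfst X M) (tsnd X M) (tproj X M) (tproj X M)"
    using tangent_pullbackD[OF T2_tangent_pullback[of E]] tangent_pullbackD[OF T2_tangent_pullback[of M]]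
    by simp_all
  have V2: "is_pullback X (bfst V) (bsnd V) (\<iota> \<cdot> tproj X E) (\<iota> \<cdot> tproj X E)"
    using fibrewise_sum_arrows(1)[OF fibrewise_sum_V] by simp
  have qp: "tanA X q \<cdot> tproj X M = tproj X E \<cdot> q" using tproj_natural[of q E M] by (simp add: hom_def)
  have D: "?\<Delta> \<in> Ar X" "Dom X ?\<Delta> = M" "Cod X ?\<Delta> = Dom X (tfst X M)"
      "?\<Delta> \<cdot> tfst X M = tzero X M" "?\<Delta> \<cdot> tsnd X M = tzero X M"
    using pairing_works[OF M2, of "tzero X M" "tzero X M"] by auto
  have j: "?j \<in> Ar X" "Dom X ?j = Dom X (bfst V)" "Cod X ?j = Dom X (tfst X E)"
      "?j \<cdot> tfst X E = bfst V \<cdot> \<iota>" "?j \<cdot> tsnd X E = bsnd V \<cdot> \<iota>"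
    using pairing_works[OF E2, of "bfst V \<cdot> \<iota>" "bsnd V \<cdot> \<iota>"] pullback_arrows(9)[OF V2] by auto
  have F: "?F \<in> Ar X" "Dom X ?F = Dom X (tfst X E)" "Cod X ?F = Dom X (tfst X M)"
      "?F \<cdot> tfst X M = tfst X E \<cdot> tanA X q" "?F \<cdot> tsnd X M = tsnd X E \<cdot> tanA X q"
    using pairing_works[OF M2, of "tfst X E \<cdot> tanA X q" "tsnd X E \<cdot> tanA X q"]
      Comp_extend[OF pullback_arrows(9)[OF E2], of q] by (auto simp: qp)
  have S: "fibrewise_sum ?P" "fibrewise_sum ?N"
    and z: "bzero ?P \<in> hom X (Cod X (bproj ?P)) (Dom X (bproj ?P))"
      "bzero ?N \<in> hom X (Cod X (bproj ?N)) (Dom X (bproj ?N))"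
    and l: "additive_morphism X ?P (T_bundle X ?P) (tzero X (Cod X (bproj ?P))) (blift ?P)"
      "additive_morphism X ?N (T_bundle X ?N) (tzero X (Cod X (bproj ?N))) (blift ?N)"
      "additive_morphism X V (T_bundle X V) (tzero X (Cod X (bproj V))) (blift V)"
    using V_lift_additive_T by (simp_all add: fibrewise_sum_tangent hom_def tlift_additive)
  have x: "xi X ?P \<in> Ar X" "Dom X (xi X ?P) = Dom X (tfst X E)" "Cod X (xi X ?P) = tanO X (tanO X E)"
    "xi X ?N \<in> Ar X" "Dom X (xi X ?N) = Dom X (tfst X M)" "Cod X (xi X ?N) = tanO X (tanO X M)"
    "xi X V \<in> Ar X" "Dom X (xi X V) = Dom X (bfst V)" "Cod X (xi X V) = tanO X (Dom X \<iota>)"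
    using xi_arrow[OF S(1) l(1)] xi_arrow[OF S(2) l(2)] xi_arrow[OF fibrewise_sum_V l(3)] by auto
  have xi_q: "xi X ?P \<cdot> tanA X (tanA X q) = ?F \<cdot> xi X ?N"
    by (rule xi_natural[OF S l(1,2) z tangent_map_additive])
      (use F tlift_natural[of q E M] in \<open>auto simp: hom_def\<close>)
  have xi_iota: "xi X V \<cdot> tanA X \<iota> = ?j \<cdot> xi X ?P"
    by (rule xi_natural[OF fibrewise_sum_V S(1) l(3,1) V_zero_in_hom z(1) iota_additive])
      (use j in \<open>auto simp: V_equations\<close>)
  have xi_zero: "?\<Delta> \<cdot> xi X ?N = tzero X M \<cdot> tanA X (tzero X M)"
    by (rule zero_xi) (use D in auto)
  have U: "tangent_pullback X (xi X ?P) (tfst X E \<cdot> tproj X E) (tanA X (tproj X E)) (tzero X E)"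
    "tangent_pullback X (xi X ?N) (tfst X M \<cdot> tproj X M) (tanA X (tproj X M)) (tzero X M)"
    using tlift_universal[of E] tlift_universal[of M] unfolding universal_lift_def by auto
  \<comment> \<open>\<open>V\<^sub>2\<close> is the fibre of \<open>T\<^sub>2q\<close> over the zero pairs.\<close>
  have 1: "tangent_pullback X ?j (bfst V \<cdot> \<tau>) ?F ?\<Delta>"
    unfolding tangent_pullback_def
  proof
    fix m
    let ?T = "tanA X ^^ m"
    note P = vertical_pullback[unfolded tangent_pullback_def, rule_format, of m]
      and E2 = T2_tangent_pullback[of E, unfolded tangent_pullback_def, rule_format, of m]
      and M2 = T2_tangent_pullback[of M, unfolded tangent_pullback_def, rule_format, of m]
      and V2 = fibrewise_sum_V[unfolded fibrewise_sum_def tangent_pullback_def, THEN conjunct1,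
        rule_format, of m]
    have "is_pullback X (?T ?j) (?T (bfst V) \<cdot> ?T \<tau>) (?T ?F) (?T ?\<Delta>)"
    proof (rule pullback_fibre_square[OF P _ E2 M2, where q = "?T q"])
      show "is_pullback X (?T (bfst V)) (?T (bsnd V)) (?T \<iota> \<cdot> ?T (tproj X E)) (?T \<iota> \<cdot> ?T (tproj X E))"
        using V2 by simp
      show "?T ?j \<cdot> ?T (tfst X E) = ?T (bfst V) \<cdot> ?T \<iota>" "?T ?j \<cdot> ?T (tsnd X E) = ?T (bsnd V) \<cdot> ?T \<iota>"
        using tanA_pow_eq[OF j(4)] tanA_pow_eq[OF j(5)] j(1-3) by simp_all
      show "?T ?F \<cdot> ?T (tfst X M) = ?T (tfst X E) \<cdot> ?T (tanA X q)"
        "?T ?F \<cdot> ?T (tsnd X M) = ?T (tsnd X E) \<cdot> ?T (tanA X q)"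
        using tanA_pow_eq[OF F(4)] tanA_pow_eq[OF F(5)] F(1-3) by simp_all
      show "?T ?\<Delta> \<cdot> ?T (tfst X M) = ?T (tzero X M)" "?T ?\<Delta> \<cdot> ?T (tsnd X M) = ?T (tzero X M)"
        using tanA_pow_Comp[of ?\<Delta> "tfst X M" m] tanA_pow_Comp[of ?\<Delta> "tsnd X M" m] D by simp_all
      show "?T (tanA X q) \<cdot> ?T (tproj X M) = ?T (tproj X E) \<cdot> ?T q"
        using tanA_pow_eq[OF qp] by simp
      show "?T (tzero X M) \<cdot> ?T (tproj X M) = Id X (Dom X (?T (tzero X M)))"
        using tanA_pow_Comp[of "tzero X M" "tproj X M" m] by (simp add: tzero_tproj)
    qed (use j(1-3) D(1-3) F(1-3) in auto)
    then show "is_pullback X (?T ?j) (?T (bfst V \<cdot> \<tau>)) (?T ?F) (?T ?\<Delta>)" by simp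
  qed
  \<comment> \<open>Pasted with the universal square of \<open>l\<^sub>M\<close>, this square becomes one with two opposite
    sides \<open>z\<^sub>M\<close> and the other two identities, since \<open>z p = id\<close>.\<close>
  have 2: "tangent_pullback X (tzero X M) ?\<Delta> (tanA X (tzero X M)) (xi X ?N)"
  proof (rule tangent_pullback_cancel[OF U(2)])
    have "?\<Delta> \<cdot> (tfst X M \<cdot> tproj X M) = Id X M"
      using D(1-3) by (simp add: Comp_extend[OF D(4)] tzero_tproj)
    then show "tangent_pullback X (tzero X M) (?\<Delta> \<cdot> (tfst X M \<cdot> tproj X M))
        (tanA X (tzero X M) \<cdot> tanA X (tproj X M)) (tzero X M)"
      using tangent_pullback_Id[of "tzero X M"] by (simp add: T_zero_split)
  qed (use x D xi_zero in auto)
  have xi_tau: "xi X V \<cdot> tanA X \<tau> = (bfst V \<cdot> \<tau>) \<cdot> tzero X M"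
  proof -
    have jF: "?j \<cdot> ?F = (bfst V \<cdot> \<tau>) \<cdot> ?\<Delta>"
      by (rule pullback_arrows(9)[OF tangent_pullbackD[OF 1]])
    \<comment> \<open>\<open>Tz\<^sub>M\<close> is split by \<open>Tp\<^sub>M\<close>, so the equation may be checked in \<open>TTM\<close>.\<close>
    have "tanA X (\<tau> \<cdot> tzero X M) = tanA X (\<iota> \<cdot> tanA X q)" by (simp only: iota_square)
    then have "tanA X \<tau> \<cdot> tanA X (tzero X M) = tanA X \<iota> \<cdot> tanA X (tanA X q)" by simp
    then have "xi X V \<cdot> (tanA X \<tau> \<cdot> tanA X (tzero X M)) = ?j \<cdot> (?F \<cdot> xi X ?N)"
      using x j(1-3) F(1-3) by (simp add: Comp_extend[OF xi_iota] xi_q)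
    also have "\<dots> = (bfst V \<cdot> \<tau>) \<cdot> (tzero X M \<cdot> tanA X (tzero X M))"
      using x j(1-3) F(1-3) D(1-3) by (simp add: Comp_extend[OF jF] xi_zero)
    finally have "(xi X V \<cdot> (tanA X \<tau> \<cdot> tanA X (tzero X M))) \<cdot> tanA X (tproj X M)
        = ((bfst V \<cdot> \<tau>) \<cdot> (tzero X M \<cdot> tanA X (tzero X M))) \<cdot> tanA X (tproj X M)" by simp
    then show ?thesis using x by (simp add: T_zero_split)
  qed
  have 3: "tangent_pullback X ?j ((bfst V \<cdot> \<tau>) \<cdot> tzero X M) (?F \<cdot> xi X ?N) (tanA X (tzero X M))"
    by (rule tangent_pullback_paste[OF tangent_pullback_sym[OF 2] 1])
  \<comment> \<open>Cancelling \<open>T\<close> of the defining square of \<open>V\<close> from the previous square.\<close>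
  have 4: "tangent_pullback X ?j (xi X V) (xi X ?P) (tanA X \<iota>)"
    by (rule tangent_pullback_cancel[OF tangent_pullback_T[OF vertical_pullback]])
      (use 3 x j xi_tau xi_q xi_iota in auto)
  have 5: "tangent_pullback X (xi X V) (?j \<cdot> (tfst X E \<cdot> tproj X E)) (tanA X \<iota> \<cdot> tanA X (tproj X E)) (tzero X E)"
    by (rule tangent_pullback_paste[OF U(1) tangent_pullback_sym[OF 4]])
  show ?thesis
    using 5 j(1-3) Comp_extend[OF j(4), of "tproj X E"] unfolding universal_lift_def by simp
qed


lemma V_differential:
  assumes "tangent_display X (bproj V)"
  shows "differential_bundle X V"
  unfolding differential_bundle_def Let_def
  using assms display_fibre_powers[OF assms] V_additive V_lift_additive_T V_lift_additive V_lift_lift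
    V_universal fibrewise_sum_V[unfolded fibrewise_sum_def] by simp

section \<open>Vertical connections and their forms\<close>

lemma linear_over_iff:
  "linear_morphism X (tangent_bundle X E) V (Id X E) R \<longleftrightarrow>
    R \<in> hom X (tanO X E) (Dom X \<iota>) \<and> R \<cdot> bproj V = tproj X E \<and> R \<cdot> blift V = tlift X E \<cdot> tanA X R"
  unfolding linear_morphism_def by (auto simp: hom_def)

text \<open>\<open>T\<iota>\<close> is monic, and it carries the vertical lift to the tangent lift.\<close>

lemma linear_iff_linear_form:
  assumes R: "R \<in> hom X (tanO X E) (Dom X \<iota>)"
  shows "linear_morphism X (tangent_bundle X E) V (Id X E) R \<longleftrightarrow>
    linear_morphism X (tangent_bundle X E) (tangent_bundle X E) (Id X E) (R \<cdot> \<iota>)"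
proof -
  have r: "R \<in> Ar X" "Dom X R = tanO X E" "Cod X R = Dom X \<iota>" using R by (auto simp: hom_def)
  have "R \<cdot> blift V = tlift X E \<cdot> tanA X R \<longleftrightarrow>
      (R \<cdot> blift V) \<cdot> tanA X \<iota> = (tlift X E \<cdot> tanA X R) \<cdot> tanA X \<iota>"
    using r T_iota_mono[of "R \<cdot> blift V" "tlift X E \<cdot> tanA X R"] by (auto simp del: Comp_assoc')
  then show ?thesis
    using r unfolding linear_morphism_def by (auto simp: hom_def V_equations)
qed

lemma form_of_connection:
  assumes R: "vertical_connection X q V \<iota> R"
  shows "vertical_connection_form X q \<iota> (R \<cdot> \<iota>)"
proof -
  have r: "R \<in> Ar X" "Dom X R = tanO X E" "Cod X R = Dom X \<iota>"
    and retraction: "\<iota> \<cdot> R = Id X (Dom X \<iota>)"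
    and lin: "linear_morphism X (tangent_bundle X E) V (Id X E) R"
    using R unfolding vertical_connection_def Let_def by (auto simp: hom_def)
  have p: "R \<cdot> (\<iota> \<cdot> tproj X E) = tproj X E" using lin linear_over_iff by simp
  have "R \<cdot> \<tau> = tproj X E \<cdot> q"
    using r Comp_extend[OF p, of q] by (simp add: tau_eq)
  from Comp_extend[OF this, of "tzero X M"]
  have "(R \<cdot> \<iota>) \<cdot> tanA X q = tproj X E \<cdot> q \<cdot> tzero X M"
    using r by (simp add: iota_square)
  moreover have "\<iota> \<cdot> (R \<cdot> \<iota>) = \<iota>" using r Comp_extend[OF retraction, of \<iota>] by simp
  moreover have "linear_morphism X (tangent_bundle X E) (tangent_bundle X E) (Id X E) (R \<cdot> \<iota>)"
    using lin linear_iff_linear_form[of R] r by (simp add: hom_def)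
  ultimately show ?thesis
    using r unfolding vertical_connection_form_def Let_def by (simp add: hom_def)
qed

lemma induces_form_iff:
  "induces_form X q V \<iota> \<phi> R \<longleftrightarrow>
    linear_morphism X (tangent_bundle X E) V (Id X E) R \<and> R \<cdot> \<iota> = \<phi>"
  unfolding induces_form_def DB_hom_def by (auto simp: linear_over_iff)

lemma induces_form_unique:
  assumes "induces_form X q V \<iota> \<phi> R" "induces_form X q V \<iota> \<phi> S"
  shows "R = S"
  by (rule iota_mono) (use assms in \<open>auto simp: induces_form_iff linear_over_iff in_hom_iff\<close>)

lemma R_of_form_eq:
  assumes "induces_form X q V \<iota> \<phi> R"
  shows "R_of_form X q V \<iota> \<phi> = R"
  unfolding R_of_form_def by (rule the_equality, rule assms, rule induces_form_unique[OF _ assms])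

text \<open>The condition on \<open>\<phi>\<close> followed by \<open>Tq\<close> is what the universal property of \<open>V\<close> requires of a map
  into \<open>TE\<close>; the remaining conditions on \<open>R\<close> are then those on \<open>\<phi>\<close>, cancelling \<open>\<iota>\<close> and \<open>T\<iota>\<close>.\<close>

lemma connection_of_form:
  assumes \<phi>: "vertical_connection_form X q \<iota> \<phi>"
  obtains R where "induces_form X q V \<iota> \<phi> R" "vertical_connection X q V \<iota> R"
proof -
  have f: "\<phi> \<in> Ar X" "Dom X \<phi> = tanO X E" "Cod X \<phi> = tanO X E"
    and fix_iota: "\<iota> \<cdot> \<phi> = \<iota>"
    and lin: "linear_morphism X (tangent_bundle X E) (tangent_bundle X E) (Id X E) \<phi>"
    and vert: "\<phi> \<cdot> tanA X q = (tproj X E \<cdot> q) \<cdot> tzero X M"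
    using \<phi> unfolding vertical_connection_form_def Let_def by (auto simp: hom_def)
  obtain R where R: "R \<in> Ar X" "Dom X R = Dom X \<phi>" "Cod X R = Dom X \<iota>" "R \<cdot> \<iota> = \<phi>"
    by (rule pullback_factor[OF tangent_pullbackD[OF vertical_pullback] _ _ _ _ _ vert])
      (use f in auto)
  have lin_R: "linear_morphism X (tangent_bundle X E) V (Id X E) R"
    using lin linear_iff_linear_form[of R] R f by (simp add: hom_def)
  have "\<iota> \<cdot> R = Id X (Dom X \<iota>)"
    by (rule iota_mono) (use R f fix_iota in auto)
  then have "vertical_connection X q V \<iota> R"
    using lin_R R f unfolding vertical_connection_def Let_def by (simp add: hom_def)
  moreover have "induces_form X q V \<iota> \<phi> R" using lin_R R by (simp add: induces_form_iff)
  ultimately show ?thesis using that by blast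
qed

lemma connection_induces_form:
  "vertical_connection X q V \<iota> R \<Longrightarrow> induces_form X q V \<iota> (R \<cdot> \<iota>) R"
  unfolding vertical_connection_def Let_def induces_form_iff by simp

end
theorem theorem3p4:
  fixes X :: "('o, 'a, 'm) tangent_data_scheme" (structure)
    and q \<iota> \<tau> :: 'a and V :: "'a bundle_data"
  assumes "tangent_category X"
    and "tangent_display X q"
    and "vertical_bundle X q V \<iota> \<tau>"
  shows
    "(tangent_display X (tproj X (Dom X q)) \<and> tangent_display X (bproj V) \<longrightarrow>
        tangent_bundle X (Dom X q) \<in> DB_obj X (Dom X q) \<and> V \<in> DB_obj X (Dom X q)) \<and>
     (\<forall>R. vertical_connection X q V \<iota> R \<longrightarrow> vertical_connection_form X q \<iota> (R \<cdot> \<iota>)) \<and>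
     (\<forall>\<phi>. vertical_connection_form X q \<iota> \<phi> \<longrightarrow>
        (\<exists>!R. induces_form X q V \<iota> \<phi> R) \<and>
        vertical_connection X q V \<iota> (R_of_form X q V \<iota> \<phi>)) \<and>
     bij_betw (\<lambda>R. R \<cdot> \<iota>)
        {R. vertical_connection X q V \<iota> R} {\<phi>. vertical_connection_form X q \<iota> \<phi>} \<and>
     (\<forall>R. vertical_connection X q V \<iota> R \<longrightarrow> R_of_form X q V \<iota> (R \<cdot> \<iota>) = R) \<and>
     (\<forall>\<phi>. vertical_connection_form X q \<iota> \<phi> \<longrightarrow> R_of_form X q V \<iota> \<phi> \<cdot> \<iota> = \<phi>)"
proof -
  interpret tangent_category X by fact
  interpret vertical X q \<iota> \<tau> V
    by unfold_locales (use assms(2,3) in \<open>auto simp: tangent_display_def\<close>)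
  have DB: "tangent_bundle X (Dom X q) \<in> DB_obj X (Dom X q) \<and> V \<in> DB_obj X (Dom X q)"
    if "tangent_display X (tproj X (Dom X q))" "tangent_display X (bproj V)"
    using tangent_bundle_differential[of "Dom X q"] V_differential that
    unfolding DB_obj_def by (simp del: bproj_V) (simp add: hom_def)
  have form: "vertical_connection_form X q \<iota> (R \<cdot> \<iota>)" if "vertical_connection X q V \<iota> R" for R
    using form_of_connection[OF that] .
  have R_form: "R_of_form X q V \<iota> (R \<cdot> \<iota>) = R" if "vertical_connection X q V \<iota> R" for R
    using R_of_form_eq[OF connection_induces_form[OF that]] .
  have conn: "(\<exists>!R. induces_form X q V \<iota> \<phi> R) \<and> vertical_connection X q V \<iota> (R_of_form X q V \<iota> \<phi>)"
    and form_R: "R_of_form X q V \<iota> \<phi> \<cdot> \<iota> = \<phi>"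
    if \<phi>: "vertical_connection_form X q \<iota> \<phi>" for \<phi>
  proof -
    obtain R where R: "induces_form X q V \<iota> \<phi> R" "vertical_connection X q V \<iota> R"
      by (rule connection_of_form[OF \<phi>])
    note eq = R_of_form_eq[OF R(1)]
    show "(\<exists>!R. induces_form X q V \<iota> \<phi> R) \<and> vertical_connection X q V \<iota> (R_of_form X q V \<iota> \<phi>)"
      unfolding eq using R induces_form_unique by blast
    show "R_of_form X q V \<iota> \<phi> \<cdot> \<iota> = \<phi>"
      unfolding eq using R(1) by (simp only: induces_form_iff)
  qed
  have "bij_betw (\<lambda>R. R \<cdot> \<iota>)
      {R. vertical_connection X q V \<iota> R} {\<phi>. vertical_connection_form X q \<iota> \<phi>}"
    by (rule bij_betw_byWitness[where f' = "R_of_form X q V \<iota>"]) (use form conn R_form form_R in auto)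
  then show ?thesis
    by (intro conjI allI impI) (use DB form R_form conn form_R in blast)+
qed

end
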